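(* Let $X$ be a weighted pure $n$-dimensional finite simplicial complex that is a two-sided $\lambda$-local-spectral expander, and define constants $\varepsilon_k$, $0\le k\le n-1$, by $\varepsilon_0=\lambda$ and $\varepsilon_k=2k(1+2k\sqrt{k})\varepsilon_{k-1}+(k+1)\lambda$ for $k>0$. If $\varepsilon_k\le\frac{1}{2(1+2(k+1)\sqrt{k+1})}$ for all $0\le k\le n-2$, then for every $0\le k\le n-1$, every $0\le j\le k$ and every $\phi\in C_0^k(X)$, $$\left\|M_k^+P_{U_k^j}\phi-\frac{k+1-j}{k+2}P_{U_k^j}\phi\right\|\le\frac{\varepsilon_k}{k+2}\left\|P_{U_k^j}\phi\right\|.$$
   Context: A finite simplicial complex $X$ is pure $n$-dimensional ($n\ge1$) if every simplex is contained in an $n$-dimensional simplex. $X(k)$ is the set of $k$-dimensional simplices, with $X(-1)=\{\emptyset\}$. A weight function is a map $m:\bigcup_{-1\le k\le n}X(k)\to(0,\infty)$ with $m(\tau)=\sum_{\sigma\in X(k+1),\,\tau\subset\sigma}m(\sigma)$ for all $-1\le k\le n-1$, $\tau\in X(k)$. $C^k(X)$ is the space of all functions $X(k)\to\mathbb{R}$ with inner product $\langle\phi,\psi\rangle=\sum_{\sigma\in X(k)}m(\sigma)\phi(\sigma)\psi(\sigma)$ and norm $\|\cdot\|$. $C_0^k(X)=\{\phi\in C^k(X):\sum_{\sigma\in X(k)}m(\sigma)\phi(\sigma)=0\}$. Signless differential: $d_k:C^k(X)\to C^{k+1}(X)$, $d_k\phi(\sigma)=\sum_{\tau\in X(k),\,\tau\subset\sigma}\phi(\tau)$,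 with adjoint $d_k^*$. For $0\le k\le n-1$ the upper random walk operator $M_k^+$ on $C^k(X)$ is $M_k^+\phi(\tau)=\sum_{\tau'\in X(k)}M_k^+(\tau,\tau')\phi(\tau')$, where $M_k^+(\tau,\tau)=\frac1{k+2}$, $M_k^+(\tau,\tau')=\frac{m(\tau\cup\tau')}{(k+2)m(\tau)}$ if $\tau\cup\tau'\in X(k+1)$, and $0$ otherwise. Subspaces of $C_0^k(X)$: $V_0^0=C_0^0(X)$; for $1\le k\le n-1$, $V_k^j=d_{k-1}\cdots d_j(C_0^j(X))$ for $0\le j\le k-1$, and $V_k^k=\ker(d_{k-1}^* )$, which is the orthogonal complement of $V_k^{k-1}$ in $C_0^k(X)$. Set $U_k^0=V_k^0$, $U_k^j=V_k^j\cap(V_k^{j-1})^\perp$ for $1\le j\le k-1$, and $U_k^k=V_k^k$. Then $C_0^k(X)=U_k^0\oplus\dots\oplus U_k^k$ orthogonally. $P_U$ denotes orthogonal projection onto $U$. For $\tau\in X(i)$, $-1\le i\le n-2$, the link $X_\tau$ is the complex of all simplices $\eta$ disjoint from $\tau$ with $\tau\cup\eta\in X$, with weight $m_\tau(\eta)=m(\tau\cup\eta)$. The non-lazy walk operator on functions $f$ on the vertices of $X_\tau$ is $f\mapsto\left(v\mapsto\sum_{w:\{v,w\}\in X_\tau(1)}\frac{m_\tau(\{v,w\})}{m_\tau(\{v\})}f(w)\right)$; it is self-adjoint with largest eigenvalue $1$; $\mu_\tau$ is its second largest eigenvalue (counted with multiplicity) and $\nu_\tau$ its smallest. $X$ is a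 two-sided $\lambda$-local-spectral expander if $-\lambda\le\nu_\tau$ and $\mu_\tau\le\lambda$ for every $\tau\in X(i)$, $-1\le i\le n-2$. *)

theory Defs
  imports "HOL-Analysis.Analysis" "HOL-Library.Function_Algebras" "HOL-Library.Multiset"
begin

subsection \<open>Weighted pure simplicial complexes\<close>

text \<open>A complex is the set of its simplices, and a simplex is a finite set of vertices. The empty
  simplex is included and has dimension \<open>-1\<close>, so dimensions are integers.\<close>

definition simplicial_complex :: "'a set set \<Rightarrow> bool" where
  "simplicial_complex X \<longleftrightarrow>
     finite X \<and> {} \<in> X \<and> (\<forall>\<sigma>\<in>X. finite \<sigma>) \<and> (\<forall>\<sigma>\<in>X. \<forall>\<tau>. \<tau> \<subseteq> \<sigma> \<longrightarrow> \<tau> \<in> X)"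

definition faces :: "'a set set \<Rightarrow> int \<Rightarrow> 'a set set" where
  "faces X k = {\<sigma> \<in> X. int (card \<sigma>) = k + 1}"

definition pure_complex :: "'a set set \<Rightarrow> nat \<Rightarrow> bool" where
  "pure_complex X n \<longleftrightarrow> simplicial_complex X \<and> (\<forall>\<tau>\<in>X. \<exists>\<sigma>\<in>faces X (int n). \<tau> \<subseteq> \<sigma>)"

text \<open>A weight is a total function of which only the values on the simplices matter.\<close>

definition weight_function :: "'a set set \<Rightarrow> nat \<Rightarrow> ('a set \<Rightarrow> real) \<Rightarrow> bool" where
  "weight_function X n m \<longleftrightarrow>
     (\<forall>k. -1 \<le> k \<and> k \<le> int n \<longrightarrow> (\<forall>\<sigma>\<in>faces X k. 0 < m \<sigma>)) \<and>
     (\<forall>k. -1 \<le> k \<and> k \<le> int n - 1 \<longrightarrow>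
        (\<forall>\<tau>\<in>faces X k. m \<tau> = (\<Sum>\<sigma> | \<sigma> \<in> faces X (k + 1) \<and> \<tau> \<subset> \<sigma>. m \<sigma>)))"


subsection \<open>Cochains\<close>

text \<open>A function on \<open>X(k)\<close> is encoded as a function on all sets of vertices that vanishes outside
  \<open>X(k)\<close>. Operators with values in such functions are therefore cut off to the right faces.\<close>

definition cochains :: "'a set set \<Rightarrow> nat \<Rightarrow> ('a set \<Rightarrow> real) set" where
  "cochains X k = {\<phi>. \<forall>\<sigma>. \<sigma> \<notin> faces X (int k) \<longrightarrow> \<phi> \<sigma> = 0}"

definition cinner ::
  "'a set set \<Rightarrow> ('a set \<Rightarrow> real) \<Rightarrow> nat \<Rightarrow> ('a set \<Rightarrow> real) \<Rightarrow> ('a set \<Rightarrow> real) \<Rightarrow> real" where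
  "cinner X m k \<phi> \<psi> = (\<Sum>\<sigma>\<in>faces X (int k). m \<sigma> * \<phi> \<sigma> * \<psi> \<sigma>)"

definition cnorm :: "'a set set \<Rightarrow> ('a set \<Rightarrow> real) \<Rightarrow> nat \<Rightarrow> ('a set \<Rightarrow> real) \<Rightarrow> real" where
  "cnorm X m k \<phi> = sqrt (cinner X m k \<phi> \<phi>)"

definition cochains0 :: "'a set set \<Rightarrow> ('a set \<Rightarrow> real) \<Rightarrow> nat \<Rightarrow> ('a set \<Rightarrow> real) set" where
  "cochains0 X m k = {\<phi> \<in> cochains X k. (\<Sum>\<sigma>\<in>faces X (int k). m \<sigma> * \<phi> \<sigma>) = 0}"

definition orth_compl ::
  "'a set set \<Rightarrow> ('a set \<Rightarrow> real) \<Rightarrow> nat \<Rightarrow> ('a set \<Rightarrow> real) set \<Rightarrow> ('a set \<Rightarrow> real) set" where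
  "orth_compl X m k W = {\<phi> \<in> cochains X k. \<forall>\<psi>\<in>W. cinner X m k \<phi> \<psi> = 0}"

definition orth_proj ::
  "'a set set \<Rightarrow> ('a set \<Rightarrow> real) \<Rightarrow> nat \<Rightarrow> ('a set \<Rightarrow> real) set \<Rightarrow> ('a set \<Rightarrow> real) \<Rightarrow> ('a set \<Rightarrow> real)" where
  "orth_proj X m k W \<phi> = (THE \<psi>. \<psi> \<in> W \<and> \<phi> - \<psi> \<in> orth_compl X m k W)"


subsection \<open>The signless differential and the upper random walk\<close>

definition sdiff :: "'a set set \<Rightarrow> nat \<Rightarrow> ('a set \<Rightarrow> real) \<Rightarrow> ('a set \<Rightarrow> real)" where
  "sdiff X k \<phi> = (\<lambda>\<sigma>. if \<sigma> \<in> faces X (int k + 1)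
     then (\<Sum>\<tau> | \<tau> \<in> faces X (int k) \<and> \<tau> \<subset> \<sigma>. \<phi> \<tau>) else 0)"

definition sdiff_adj ::
  "'a set set \<Rightarrow> ('a set \<Rightarrow> real) \<Rightarrow> nat \<Rightarrow> ('a set \<Rightarrow> real) \<Rightarrow> ('a set \<Rightarrow> real)" where
  "sdiff_adj X m k \<psi> = (THE \<xi>. \<xi> \<in> cochains X k \<and>
     (\<forall>\<phi>\<in>cochains X k. cinner X m (k + 1) (sdiff X k \<phi>) \<psi> = cinner X m k \<phi> \<xi>))"

text \<open>\<open>sdiff_iter X j r\<close> is \<open>d\<^bsub>j+r-1\<^esub> \<dots> d\<^bsub>j\<^esub>\<close>, with \<open>r\<close> factors.\<close>

primrec sdiff_iter :: "'a set set \<Rightarrow> nat \<Rightarrow> nat \<Rightarrow> ('a set \<Rightarrow> real) \<Rightarrow> ('a set \<Rightarrow> real)" where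
  "sdiff_iter X j 0 \<phi> = \<phi>"
| "sdiff_iter X j (Suc r) \<phi> = sdiff X (j + r) (sdiff_iter X j r \<phi>)"

definition upper_walk_entry ::
  "'a set set \<Rightarrow> ('a set \<Rightarrow> real) \<Rightarrow> nat \<Rightarrow> 'a set \<Rightarrow> 'a set \<Rightarrow> real" where
  "upper_walk_entry X m k \<tau> \<tau>' =
     (if \<tau> = \<tau>' then 1 / (real k + 2)
      else if \<tau> \<union> \<tau>' \<in> faces X (int k + 1) then m (\<tau> \<union> \<tau>') / ((real k + 2) * m \<tau>)
      else 0)"

definition upper_walk ::
  "'a set set \<Rightarrow> ('a set \<Rightarrow> real) \<Rightarrow> nat \<Rightarrow> ('a set \<Rightarrow> real) \<Rightarrow> ('a set \<Rightarrow> real)" where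
  "upper_walk X m k \<phi> = (\<lambda>\<tau>. if \<tau> \<in> faces X (int k)
     then (\<Sum>\<tau>'\<in>faces X (int k). upper_walk_entry X m k \<tau> \<tau>' * \<phi> \<tau>') else 0)"


subsection \<open>The subspaces \<open>V\<close> and \<open>U\<close>\<close>

text \<open>\<open>Vspace X m k j\<close> and \<open>Uspace X m k j\<close> are \<open>V\<close> and \<open>U\<close> with lower index \<open>k\<close> and upper index
  \<open>j\<close>; they are meaningful for \<open>j \<le> k\<close> only.\<close>

definition Vspace :: "'a set set \<Rightarrow> ('a set \<Rightarrow> real) \<Rightarrow> nat \<Rightarrow> nat \<Rightarrow> ('a set \<Rightarrow> real) set" where
  "Vspace X m k j =
     (if j < k then sdiff_iter X j (k - j) ` cochains0 X m j
      else if k = 0 then cochains0 X m 0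
      else {\<phi> \<in> cochains X k. sdiff_adj X m (k - 1) \<phi> = 0})"

definition Uspace :: "'a set set \<Rightarrow> ('a set \<Rightarrow> real) \<Rightarrow> nat \<Rightarrow> nat \<Rightarrow> ('a set \<Rightarrow> real) set" where
  "Uspace X m k j =
     (if j = 0 \<or> j = k then Vspace X m k j
      else Vspace X m k j \<inter> orth_compl X m k (Vspace X m k (j - 1)))"


subsection \<open>Links and local spectral expansion\<close>

definition link :: "'a set set \<Rightarrow> 'a set \<Rightarrow> 'a set set" where
  "link X \<tau> = {\<eta> \<in> X. \<eta> \<inter> \<tau> = {} \<and> \<tau> \<union> \<eta> \<in> X}"

definition link_weight :: "('a set \<Rightarrow> real) \<Rightarrow> 'a set \<Rightarrow> 'a set \<Rightarrow> real" where
  "link_weight m \<tau> = (\<lambda>\<eta>. m (\<tau> \<union> \<eta>))"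

text \<open>Functions on the vertices of \<open>Y\<close> are encoded as functions on the vertex type that vanish off
  the vertices of \<open>Y\<close>.\<close>

definition vertex_funs :: "'a set set \<Rightarrow> ('a \<Rightarrow> real) set" where
  "vertex_funs Y = {f. \<forall>v. {v} \<notin> faces Y 0 \<longrightarrow> f v = 0}"

definition graph_walk :: "'a set set \<Rightarrow> ('a set \<Rightarrow> real) \<Rightarrow> ('a \<Rightarrow> real) \<Rightarrow> ('a \<Rightarrow> real)" where
  "graph_walk Y w f = (\<lambda>v. if {v} \<in> faces Y 0
     then (\<Sum>u | {v, u} \<in> faces Y 1. w {v, u} / w {v} * f u) else 0)"

definition walk_eigenspace :: "'a set set \<Rightarrow> ('a set \<Rightarrow> real) \<Rightarrow> real \<Rightarrow> ('a \<Rightarrow> real) set" where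
  "walk_eigenspace Y w c = {f \<in> vertex_funs Y. graph_walk Y w f = (\<lambda>v. c * f v)}"

definition walk_eigenvalues :: "'a set set \<Rightarrow> ('a set \<Rightarrow> real) \<Rightarrow> real set" where
  "walk_eigenvalues Y w = {c. \<exists>f\<in>walk_eigenspace Y w c. f \<noteq> 0}"

text \<open>Real functions on an arbitrary type form a vector space, but the library has no
  \<open>real_vector\<close> instance for the function type, hence the explicit scaling.\<close>

definition fun_scale :: "real \<Rightarrow> ('b \<Rightarrow> real) \<Rightarrow> ('b \<Rightarrow> real)" where
  "fun_scale c f = (\<lambda>x. c * f x)"

lemma vector_space_fun_scale: "vector_space fun_scale"
  by unfold_locales (auto simp: fun_scale_def fun_eq_iff algebra_simps)

text \<open>The eigenvalues with multiplicity. The walk is self-adjoint for the weighted inner product,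
  so the multiplicity of an eigenvalue is the dimension of its eigenspace.\<close>

definition walk_spectrum :: "'a set set \<Rightarrow> ('a set \<Rightarrow> real) \<Rightarrow> real multiset" where
  "walk_spectrum Y w = (\<Sum>c\<in>walk_eigenvalues Y w.
     replicate_mset (vector_space.dim fun_scale (walk_eigenspace Y w c)) c)"

definition second_largest_eigenvalue :: "'a set set \<Rightarrow> ('a set \<Rightarrow> real) \<Rightarrow> real" where
  "second_largest_eigenvalue Y w = rev (sorted_list_of_multiset (walk_spectrum Y w)) ! 1"

definition smallest_eigenvalue :: "'a set set \<Rightarrow> ('a set \<Rightarrow> real) \<Rightarrow> real" where
  "smallest_eigenvalue Y w = Min (walk_eigenvalues Y w)"

definition two_sided_local_spectral_expander ::
  "'a set set \<Rightarrow> nat \<Rightarrow> ('a set \<Rightarrow> real) \<Rightarrow> real \<Rightarrow> bool" where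
  "two_sided_local_spectral_expander X n m lam \<longleftrightarrow>
     (\<forall>i. -1 \<le> i \<and> i \<le> int n - 2 \<longrightarrow> (\<forall>\<tau>\<in>faces X i.
        - lam \<le> smallest_eigenvalue (link X \<tau>) (link_weight m \<tau>) \<and>
        second_largest_eigenvalue (link X \<tau>) (link_weight m \<tau>) \<le> lam))"


subsection \<open>The error constants\<close>

primrec eps :: "real \<Rightarrow> nat \<Rightarrow> real" where
  "eps lam 0 = lam"
| "eps lam (Suc k) =
     2 * real (Suc k) * (1 + 2 * real (Suc k) * sqrt (real (Suc k))) * eps lam k
     + (real (Suc k) + 1) * lam"

end

theory Submission
  imports Defs
begin

text \<open>
  Write \<open>d\<^sub>c\<close> for the signless differential from the simplices with \<open>c\<close> vertices to those with
  \<open>c + 1\<close>, and \<open>d\<^sub>c\<^sup>*\<close> for its adjoint; the upper walk in dimension \<open>k\<close> is \<open>d\<^sup>* d / (k + 2)\<close>, with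
  \<open>d = d\<^bsub>k+1\<^esub>\<close>. Two facts carry the argument.

  \<^item> Going up and down is almost the identity plus going down and up: on simplices with \<open>c\<close>
  vertices, the operator \<open>d\<^sub>c\<^sup>* d\<^sub>c - I - d\<^bsub>c-1\<^esub> d\<^bsub>c-1\<^esub>\<^sup>*\<close> has norm at most \<open>c \<lambda>\<close>
  (\<open>up_down_walk_difference\<close>). Two distinct adjacent simplices share exactly one facet \<open>\<eta>\<close>, so the
  quadratic form of \<open>d\<^sub>c\<^sup>* d\<^sub>c - I\<close> splits into the forms of the walks on the links of the \<open>\<eta>\<close>, while
  that of \<open>d\<^bsub>c-1\<^esub> d\<^bsub>c-1\<^esub>\<^sup>*\<close> splits into the forms of the projections to constants on these links.
  On each link the two differ by at most \<open>\<lambda>\<close> times the norm squared, which is what two-sided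
  spectral expansion says (\<open>expander_walk_near_mean\<close>).

  \<^item> The subspaces \<open>U\<close> are the successive orthogonal complements in one filtration
  (\<open>Fil\<close>, \<open>Uspace_eq\<close>), and the differential maps each step of the filtration in one dimension onto
  the step with the same index in the next.

  The theorem follows by induction on \<open>k\<close> (\<open>up_walk_near_scalar_on_Ucomp\<close>). For \<open>j = k\<close> a vector of
  \<open>U\<close> is killed by \<open>d\<^sup>*\<close> and the first fact is enough. For \<open>j < k\<close> it has the form \<open>d \<theta>\<close> with \<open>\<theta>\<close> in
  step \<open>j\<close> of the filtration one dimension below. Decompose \<open>\<theta>\<close> into its components in the \<open>U\<close> with index
  at most \<open>j\<close>. By induction \<open>d\<^sup>* d\<close> acts on them almost as scalars, and as \<open>d \<theta>\<close> is orthogonal to the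
  images of the components with index less than \<open>j\<close>, those components are small. Hence \<open>\<theta>\<close> is almost an
  eigenvector of \<open>d\<^sup>* d\<close> (\<open>near_eigenvector_step\<close>), \<open>d \<theta>\<close> is almost one of \<open>d d\<^sup>*\<close>, and the first fact
  passes from \<open>d d\<^sup>*\<close> to the walk.

  The second largest eigenvalue, defined by sorting the spectrum, is reached without the spectral
  theorem: the maximum of the Rayleigh quotient over the functions orthogonal to the constants is
  attained, a maximizer is an eigenvector, and its eigenvalue occurs in the spectrum next to the
  eigenvalue \<open>1\<close> of the constants.
\<close>


section \<open>Weighted inner products on finite sets\<close>

interpretation fs: vector_space fun_scale
  by (rule vector_space_fun_scale)

lemma fun_scale_apply [simp]: "fun_scale c f x = c * f x"
  by (simp add: fun_scale_def)

lemma sum_apply: "(\<Sum>i\<in>A. f i) x = (\<Sum>i\<in>A. f i x)" for f :: "'i \<Rightarrow> 'b \<Rightarrow> real"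
  by (induction A rule: infinite_finite_induct) auto

text \<open>Both the cochains and the functions on the vertices of a link are functions that vanish off a
  finite set \<open>S\<close>, with the inner product weighted by \<open>w\<close>. The functions are total, so that addition
  and scaling are available, and \<open>wip\<close> only sees their values on \<open>S\<close>.\<close>

definition wip :: "'b set \<Rightarrow> ('b \<Rightarrow> real) \<Rightarrow> ('b \<Rightarrow> real) \<Rightarrow> ('b \<Rightarrow> real) \<Rightarrow> real" where
  "wip S w f g = (\<Sum>x\<in>S. w x * f x * g x)"

definition wnorm :: "'b set \<Rightarrow> ('b \<Rightarrow> real) \<Rightarrow> ('b \<Rightarrow> real) \<Rightarrow> real" where
  "wnorm S w f = sqrt (wip S w f f)"

definition supported :: "'b set \<Rightarrow> ('b \<Rightarrow> real) set" where
  "supported S = {f. \<forall>x. x \<notin> S \<longrightarrow> f x = 0}"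

lemma wip_commute: "wip S w f g = wip S w g f"
  by (simp add: wip_def mult.commute mult.left_commute)

lemma wip_zero [simp]: "wip S w 0 g = 0" "wip S w f 0 = 0"
  by (simp_all add: wip_def)

lemma wip_linear:
  "wip S w (f + g) h = wip S w f h + wip S w g h"
  "wip S w h (f + g) = wip S w h f + wip S w h g"
  "wip S w (f - g) h = wip S w f h - wip S w g h"
  "wip S w h (f - g) = wip S w h f - wip S w h g"
  "wip S w (fun_scale c f) h = c * wip S w f h"
  "wip S w h (fun_scale c f) = c * wip S w h f"
  by (simp_all add: wip_def sum.distrib sum_subtractf sum_distrib_left algebra_simps)

lemma wip_sum_left: "wip S w (\<Sum>i\<in>I. f i) h = (\<Sum>i\<in>I. wip S w (f i) h)"
  unfolding wip_def sum_apply by (subst sum.swap) (simp add: sum_distrib_left sum_distrib_right)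

lemma wip_sum_right: "wip S w h (\<Sum>i\<in>I. f i) = (\<Sum>i\<in>I. wip S w h (f i))"
  by (simp add: wip_commute[of S w h] wip_sum_left)

lemma wip_cong:
  assumes "\<And>x. x \<in> S \<Longrightarrow> f x = f' x" "\<And>x. x \<in> S \<Longrightarrow> g x = g' x"
  shows "wip S w f g = wip S w f' g'"
  using assms by (simp add: wip_def)

lemma subspace_supported: "fs.subspace (supported S)"
  by (simp add: fs.subspace_def supported_def)

locale weighted_set =
  fixes S :: "'b set" and w :: "'b \<Rightarrow> real"
  assumes finite_S: "finite S" and w_pos: "x \<in> S \<Longrightarrow> 0 < w x"
begin

lemma wip_nonneg: "0 \<le> wip S w f f"
  unfolding wip_def using w_pos by (intro sum_nonneg) (auto simp: mult.assoc less_imp_le)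

lemma wnorm_nonneg [simp]: "0 \<le> wnorm S w f"
  by (simp add: wnorm_def wip_nonneg)

lemma wnorm_power2: "(wnorm S w f)\<^sup>2 = wip S w f f"
  by (simp add: wnorm_def wip_nonneg)

lemma wip_self_eq_0_iff:
  assumes "f \<in> supported S"
  shows "wip S w f f = 0 \<longleftrightarrow> f = 0"
proof
  assume "wip S w f f = 0"
  then have "\<forall>x\<in>S. w x * f x * f x = 0"
    unfolding wip_def using w_pos
    by (subst (asm) sum_nonneg_eq_0_iff[OF finite_S]) (auto simp: mult.assoc less_imp_le)
  then have "\<forall>x\<in>S. f x = 0" using w_pos by fastforce
  then show "f = 0" using assms by (auto simp: supported_def fun_eq_iff)
qed simp

lemma wnorm_L2_set: "wnorm S w f = L2_set (\<lambda>x. sqrt (w x) * f x) S"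
  unfolding wnorm_def wip_def L2_set_def
  using w_pos by (intro arg_cong[of _ _ sqrt] sum.cong)
    (auto simp: power_mult_distrib power2_eq_square less_imp_le)

lemma wnorm_triangle: "wnorm S w (f + g) \<le> wnorm S w f + wnorm S w g"
  using L2_set_triangle_ineq[of "\<lambda>x. sqrt (w x) * f x" "\<lambda>x. sqrt (w x) * g x" S]
  by (simp add: wnorm_L2_set algebra_simps)

lemma wnorm_scale: "wnorm S w (fun_scale c f) = \<bar>c\<bar> * wnorm S w f"
  by (simp add: wnorm_def wip_linear real_sqrt_mult mult.assoc[symmetric])

lemma wnorm_sum: "wnorm S w (\<Sum>i\<in>I. f i) \<le> (\<Sum>i\<in>I. wnorm S w (f i))"
proof (induction I rule: infinite_finite_induct)
  case (insert i I)
  have "wnorm S w (f i + (\<Sum>i\<in>I. f i)) \<le> wnorm S w (f i) + (\<Sum>i\<in>I. wnorm S w (f i))"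
    using wnorm_triangle[of "f i" "\<Sum>i\<in>I. f i"] insert.IH by linarith
  \<comment> \<open>Pointwise rules would unfold the eta-expanded sums in the induction cases.\<close>
  then show ?case using insert.hyps by (simp del: plus_fun_apply)
qed (simp_all add: wnorm_def del: zero_fun_apply)

lemma wip_Cauchy_Schwarz: "\<bar>wip S w f g\<bar> \<le> wnorm S w f * wnorm S w g"
proof -
  have "\<bar>wip S w f g\<bar> \<le> (\<Sum>x\<in>S. \<bar>w x * f x * g x\<bar>)"
    unfolding wip_def by (rule sum_abs)
  also have "\<dots> = (\<Sum>x\<in>S. \<bar>sqrt (w x) * f x\<bar> * \<bar>sqrt (w x) * g x\<bar>)"
    using w_pos by (intro sum.cong refl) (auto simp: abs_mult less_imp_le)
  also have "\<dots> \<le> wnorm S w f * wnorm S w g"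
    unfolding wnorm_L2_set by (rule L2_set_mult_ineq)
  finally show ?thesis .
qed

lemma supported_finite_span:
  obtains B where "finite B" "supported S \<subseteq> fs.span B"
proof
  let ?b = "\<lambda>x y. if y = x then 1 else (0::real)"
  show "finite (?b ` S)" using finite_S by simp
  show "supported S \<subseteq> fs.span (?b ` S)"
  proof
    fix f assume f: "f \<in> supported S"
    have "f = (\<Sum>x\<in>S. fun_scale (f x) (?b x))"
    proof
      fix y
      have "(\<Sum>x\<in>S. f x * ?b x y) = (if y \<in> S then f y else 0)"
        by (simp add: finite_S if_distrib cong: if_cong)
      then show "f y = (\<Sum>x\<in>S. fun_scale (f x) (?b x)) y"
        using f by (auto simp: sum_apply supported_def)
    qed
    also have "\<dots> \<in> fs.span (?b ` S)"
      by (intro fs.span_sum fs.span_scale fs.span_base) auto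
    finally show "f \<in> fs.span (?b ` S)" .
  qed
qed

lemma finite_independent_supported:
  assumes "fs.independent A" "A \<subseteq> supported S"
  shows "finite A"
  using supported_finite_span fs.independent_span_bound assms by (metis subset_trans)

text \<open>The ambient space of all functions may have infinite dimension, where \<open>dim\<close> is not monotone; on
  functions supported by \<open>S\<close> bases are finite and extending an independent set bounds its size.\<close>

lemma card_le_dim_supported:
  assumes "fs.independent A" "A \<subseteq> W" "W \<subseteq> supported S"
  shows "card A \<le> fs.dim W"
proof -
  obtain B where B: "A \<subseteq> B" "B \<subseteq> W" "fs.independent B" "W \<subseteq> fs.span B"
    using fs.maximal_independent_subset_extend assms(1,2) by metis
  have "finite B" using finite_independent_supported B assms(3) by blast
  then have "card A \<le> card B" using B(1) card_mono by blast
  also have "card B = fs.dim W" using B by (intro fs.basis_card_eq_dim) auto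
  finally show ?thesis .
qed

lemma independent_orthogonal:
  assumes sub: "A \<subseteq> supported S" and nz: "0 \<notin> A"
    and orth: "\<And>f g. f \<in> A \<Longrightarrow> g \<in> A \<Longrightarrow> f \<noteq> g \<Longrightarrow> wip S w f g = 0"
  shows "fs.independent A"
  unfolding fs.dependent_explicit
proof safe
  fix T u f assume T: "finite T" "T \<subseteq> A" and 0: "(\<Sum>v\<in>T. fun_scale (u v) v) = 0"
    and f: "f \<in> T" "u f \<noteq> 0"
  have "0 = wip S w (\<Sum>v\<in>T. fun_scale (u v) v) f" by (simp add: 0)
  also have "\<dots> = (\<Sum>v\<in>T. u v * wip S w v f)" by (simp add: wip_sum_left wip_linear)
  also have "\<dots> = (\<Sum>v\<in>T. if v = f then u f * wip S w f f else 0)"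
    using T f orth by (intro sum.cong refl) (auto simp: subset_iff)
  also have "\<dots> = u f * wip S w f f" using T f by simp
  finally have "wip S w f f = 0" using f by simp
  then have "f = 0" using wip_self_eq_0_iff sub T f by blast
  then show False using nz T f by blast
qed

text \<open>Gram-Schmidt on a finite basis: the projection to the span of \<open>insert b B\<close> adds to that for \<open>B\<close>
  the projection to the component \<open>c\<close> of \<open>b\<close> orthogonal to \<open>B\<close>.\<close>

lemma projection_exists:
  assumes W: "fs.subspace W" "W \<subseteq> supported S"
  obtains p where "p \<in> W" "\<And>g. g \<in> W \<Longrightarrow> wip S w (f - p) g = 0"
proof -
  have fin: "\<exists>p\<in>fs.span B. \<forall>g\<in>fs.span B. wip S w (f - p) g = 0"
    if "finite B" "B \<subseteq> supported S" for B and f :: "'b \<Rightarrow> real"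
    using that
  proof (induction B arbitrary: f rule: finite_induct)
    case empty
    then show ?case by (intro bexI[of _ 0]) (auto simp del: zero_fun_apply fun_scale_apply)
  next
    case (insert b B)
    obtain q where q: "q \<in> fs.span B" "\<forall>g\<in>fs.span B. wip S w (f - q) g = 0"
      using insert by blast
    obtain r where r: "r \<in> fs.span B" "\<forall>g\<in>fs.span B. wip S w (b - r) g = 0"
      using insert by blast
    define c where "c = b - r"
    \<comment> \<open>If \<open>b\<close> lies in the span of \<open>B\<close> then \<open>c = 0\<close>, and division by zero makes \<open>p = q\<close>.\<close>
    define p where "p = q + fun_scale (wip S w f c / wip S w c c) c"
    have mono: "g \<in> fs.span (insert b B)" if "g \<in> fs.span B" for g
      using that fs.span_mono[of B "insert b B"] by blast
    have c_in: "c \<in> fs.span (insert b B)"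
      unfolding c_def by (rule fs.span_diff[OF fs.span_base mono[OF r(1)]]) simp
    have "b \<in> supported S" "r \<in> supported S"
      using insert.prems r(1) fs.span_minimal[OF _ subspace_supported] by blast+
    then have c0: "wip S w c c = 0 \<longleftrightarrow> c = 0"
      unfolding c_def by (intro wip_self_eq_0_iff fs.subspace_diff[OF subspace_supported])
    have cB: "wip S w c g = 0" "wip S w g c = 0" if "g \<in> fs.span B" for g
      using r(2) that by (auto simp: c_def wip_commute[of S w g])
    have "wip S w (f - p) g = 0" if g: "g \<in> fs.span (insert b B)" for g
    proof -
      obtain k where "g - fun_scale k b \<in> fs.span B" using g fs.span_breakdown_eq by metis
      then have h: "g - fun_scale k b + fun_scale k r \<in> fs.span B" (is "?h \<in> _")
        using r(1) by (intro fs.span_add fs.span_scale)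
      have g_eq: "g = ?h + fun_scale k c"
        by (simp add: c_def fun_eq_iff algebra_simps)
      have "wip S w (f - p) ?h = 0"
        using q(2) h cB(1)[OF h] by (simp add: p_def wip_linear(1,3,5))
      moreover have "wip S w (f - p) c = 0"
        using c0 cB(2)[OF q(1)] by (cases "c = 0") (simp_all add: p_def wip_linear)
      ultimately show ?thesis by (subst g_eq, subst wip_linear(2), subst wip_linear(6)) simp
    qed
    moreover have "p \<in> fs.span (insert b B)"
      unfolding p_def using mono[OF q(1)] c_in by (intro fs.span_add fs.span_scale)
    ultimately show ?case by blast
  qed
  obtain B where B: "B \<subseteq> W" "fs.independent B" "W \<subseteq> fs.span B"
    using fs.maximal_independent_subset by blast
  have "finite B" using finite_independent_supported B W(2) by blast
  moreover have "fs.span B = W"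
    using B fs.span_minimal[OF B(1) W(1)] by blast
  ultimately show ?thesis using fin[of B f] B(1) W(2) that by fastforce
qed

lemma projection_unique:
  assumes W: "fs.subspace W" "W \<subseteq> supported S" and "p \<in> W" "q \<in> W"
    and p: "\<And>g. g \<in> W \<Longrightarrow> wip S w (f - p) g = 0" and q: "\<And>g. g \<in> W \<Longrightarrow> wip S w (f - q) g = 0"
  shows "p = q"
proof -
  have d: "p - q \<in> W" using assms by (intro fs.subspace_diff)
  have "wip S w (p - q) (p - q) = wip S w (f - q) (p - q) - wip S w (f - p) (p - q)"
    by (simp add: wip_linear)
  also have "\<dots> = 0" using p q d by simp
  finally have "p - q = 0" using wip_self_eq_0_iff d W(2) by blast
  then show ?thesis by simp
qed

text \<open>Polarization bounds \<open>(T f, v)\<close> by values of the quadratic form: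
  \<open>4 (T f, v) = (T (f + v), f + v) - (T (f - v), f - v)\<close>.\<close>

lemma selfadjoint_norm_bound:
  assumes W: "fs.subspace W"
    and T: "\<And>f. f \<in> W \<Longrightarrow> T f \<in> W"
    and add: "\<And>f g. T (f + g) = T f + T g"
    and scale: "\<And>c f. T (fun_scale c f) = fun_scale c (T f)"
    and adj: "\<And>f g. f \<in> W \<Longrightarrow> g \<in> W \<Longrightarrow> wip S w (T f) g = wip S w f (T g)"
    and quad: "\<And>f. f \<in> W \<Longrightarrow> \<bar>wip S w (T f) f\<bar> \<le> c * wip S w f f"
    and f: "f \<in> W"
  shows "wnorm S w (T f) \<le> c * wnorm S w f"
proof (cases "wnorm S w (T f) = 0 \<or> wnorm S w f = 0")
  case True
  have "wnorm S w (T f) = 0" if "wnorm S w f = 0"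
  proof -
    have "(wnorm S w (T f))\<^sup>2 = wip S w f (T (T f))" using adj[OF f T[OF f]] by (simp add: wnorm_power2)
    also have "\<dots> \<le> wnorm S w f * wnorm S w (T (T f))" using wip_Cauchy_Schwarz abs_le_D1 by blast
    finally show ?thesis using that by simp
  qed
  moreover have "0 \<le> c * wip S w f f" using quad[OF f] by linarith
  then have "0 \<le> (c * wnorm S w f) * wnorm S w f"
    by (simp add: wnorm_power2[symmetric] power2_eq_square mult.assoc)
  then have "0 \<le> c * wnorm S w f"
    using wnorm_nonneg[of f] by (cases "wnorm S w f = 0") (auto simp: zero_le_mult_iff)
  ultimately show ?thesis using True by auto
next
  case False
  define a where "a = wnorm S w f"
  define b where "b = wnorm S w (T f)"
  have ab: "0 < a" "0 < b" using False by (simp_all add: a_def b_def order_less_le)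
  \<comment> \<open>Polarize with a multiple \<open>v\<close> of \<open>T f\<close> that has the same norm as \<open>f\<close>.\<close>
  define v where "v = fun_scale (a / b) (T f)"
  have v: "v \<in> W" unfolding v_def using W T[OF f] by (rule fs.subspace_scale)
  have neg: "T (f - v) = T f - T v"
    using add[of f "fun_scale (-1) v"] scale[of "-1" v]
    by (simp add: fun_eq_iff)
  have "4 * wip S w (T f) v = wip S w (T (f + v)) (f + v) - wip S w (T (f - v)) (f - v)"
    using adj[OF v f] by (simp add: add neg wip_linear wip_commute[of S w v])
  also have "\<dots> \<le> c * wip S w (f + v) (f + v) + c * wip S w (f - v) (f - v)"
    using quad[of "f + v"] quad[of "f - v"] W f v fs.subspace_add fs.subspace_diff
    by (smt (verit))
  also have "\<dots> = 2 * c * (wip S w f f + wip S w v v)"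
    by (simp add: wip_linear algebra_simps)
  also have "wip S w v v = a\<^sup>2"
    using ab by (simp add: v_def wip_linear b_def[symmetric] wnorm_power2[symmetric] power2_eq_square)
  also have "wip S w f f = a\<^sup>2" by (simp add: a_def wnorm_power2)
  finally have "4 * wip S w (T f) v \<le> 4 * c * a\<^sup>2" by simp
  moreover have "wip S w (T f) v = a * b"
    using ab by (simp add: v_def wip_linear b_def[symmetric] wnorm_power2[symmetric] power2_eq_square)
  ultimately have "a * b \<le> a * (c * a)" by (simp add: power2_eq_square mult_ac)
  then show ?thesis using ab by (simp add: a_def b_def)
qed

lemma continuous_wip: 
  assumes "\<And>x. x \<in> S \<Longrightarrow> continuous_on UNIV (\<lambda>f. F f x)" "\<And>x. x \<in> S \<Longrightarrow> continuous_on UNIV (\<lambda>f. G f x)"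
  shows "continuous_on UNIV (\<lambda>f. wip S w (F f) (G f))"
  unfolding wip_def by (intro continuous_intros assms)

text \<open>In the product topology on functions the sphere is a closed subset of a box, which is compact by
  Tychonoff; so no choice of coordinates is needed.\<close>

lemma compact_unit_sphere:
  assumes "closed W" "W \<subseteq> supported S"
  shows "compact {f \<in> W. wip S w f f = 1}"
proof -
  define b where "b x = (if x \<in> S then 1 / sqrt (w x) else 0)" for x
  define box where "box = (\<Pi>\<^sub>E x\<in>UNIV. {- b x .. b x})"
  have "compactin (product_topology (\<lambda>x. euclidean) UNIV) box"
    unfolding box_def by (subst compactin_PiE) auto
  then have comp: "compact box" by (simp add: euclidean_product_topology)
  have "closed ({f. wip S w f f = 1} \<inter> W)"
    using assms(1) by (intro closed_Int closed_Collect_eq continuous_wip) auto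
  then have "compact (box \<inter> ({f. wip S w f f = 1} \<inter> W))"
    using comp by (rule compact_Int_closed[rotated])
  moreover have "f \<in> box" if f: "f \<in> supported S" "wip S w f f = 1" for f
  proof -
    have "\<bar>f x\<bar> \<le> b x" for x
    proof (cases "x \<in> S")
      case True
      have "w x * f x * f x \<le> wip S w f f"
        unfolding wip_def using w_pos True
        by (intro member_le_sum finite_S) (auto simp: mult.assoc less_imp_le)
      then have "w x * (f x)\<^sup>2 \<le> 1" using f by (simp add: power2_eq_square)
      then have "(f x)\<^sup>2 \<le> 1 / w x" using w_pos[OF True] by (simp add: field_simps)
      then have "sqrt ((f x)\<^sup>2) \<le> sqrt (1 / w x)" by (rule real_sqrt_le_mono)
      then show ?thesis using True by (simp add: b_def real_sqrt_divide)
    qed (use f in \<open>auto simp: supported_def b_def\<close>)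
    then show ?thesis by (auto simp: box_def abs_le_iff minus_le_iff)
  qed
  then have "box \<inter> ({f. wip S w f f = 1} \<inter> W) = {f \<in> W. wip S w f f = 1}"
    using assms(2) by blast
  ultimately show ?thesis by simp
qed

text \<open>The variational characterization of the top eigenvalue on an invariant subspace. It replaces the
  spectral theorem: one eigenvector that dominates the quadratic form is all that the bounds on
  links require.\<close>

lemma Rayleigh_maximizer:
  assumes W: "fs.subspace W" "closed W" "W \<subseteq> supported S" and nz: "W \<noteq> {0}"
    and T: "\<And>f. f \<in> W \<Longrightarrow> T f \<in> W"
    and add: "\<And>f g. T (f + g) = T f + T g"
    and scale: "\<And>c f. T (fun_scale c f) = fun_scale c (T f)"
    and adj: "\<And>f g. f \<in> W \<Longrightarrow> g \<in> W \<Longrightarrow> wip S w (T f) g = wip S w f (T g)"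
    and cont: "continuous_on UNIV (\<lambda>f. wip S w (T f) f)"
  obtains g c where "g \<in> W" "g \<noteq> 0" "T g = fun_scale c g"
    "\<And>f. f \<in> W \<Longrightarrow> wip S w (T f) f \<le> c * wip S w f f"
proof -
  let ?K = "{f \<in> W. wip S w f f = 1}"
  have normalize: "fun_scale (1 / wnorm S w f) f \<in> ?K" if "f \<in> W" "f \<noteq> 0" for f
  proof -
    have "wip S w f f > 0"
      using wip_self_eq_0_iff W(3) that wip_nonneg[of f] by (metis order_less_le subsetD)
    then show ?thesis
      using that W(1) by (auto simp: wip_linear fs.subspace_scale wnorm_def)
  qed
  obtain f0 where "f0 \<in> W" "f0 \<noteq> 0" using nz fs.subspace_0[OF W(1)] by blast
  then have "?K \<noteq> {}" using normalize by blast
  then obtain g where g: "g \<in> W" "wip S w g g = 1"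
    and max: "\<And>f. f \<in> ?K \<Longrightarrow> wip S w (T f) f \<le> wip S w (T g) g"
    using continuous_attains_sup[OF compact_unit_sphere[OF W(2,3)] _ continuous_on_subset[OF cont subset_UNIV]]
    by blast
  define c where "c = wip S w (T g) g"
  have T0: "T 0 = 0" using scale[of 0 0] by (simp add: fun_eq_iff)
  have quad: "wip S w (T f) f \<le> c * wip S w f f" if f: "f \<in> W" for f
  proof (cases "f = 0")
    case False
    define r where "r = wnorm S w f"
    have r: "r \<noteq> 0" "wip S w f f = r\<^sup>2"
      using f False W(3) wip_self_eq_0_iff wnorm_power2[of f] by (auto simp: r_def)
    have "wip S w (T f) f / r\<^sup>2 \<le> c"
      using max[OF normalize[OF f False]]
      by (simp add: scale wip_linear c_def r_def[symmetric] power2_eq_square)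
    then show ?thesis using r by (simp add: divide_le_eq)
  qed (simp add: T0)
  \<comment> \<open>The form \<open>c |f|\<^sup>2 - (T f, f)\<close> is nonnegative on \<open>W\<close> and vanishes at \<open>g\<close>, so its first
    variation at \<open>g\<close> vanishes in every direction of \<open>W\<close>, in particular in the direction \<open>h\<close>.\<close>
  define h where "h = T g - fun_scale c g"
  have h: "h \<in> W" unfolding h_def using W(1) T g by (intro fs.subspace_diff fs.subspace_scale)
  define A where "A = wip S w h h"
  define B where "B = wip S w (T h) h - c * wip S w h h"
  have var: "2 * t * A + t\<^sup>2 * B \<le> 0" for t
  proof -
    have "g + fun_scale t h \<in> W" using W(1) g h by (intro fs.subspace_add fs.subspace_scale)
    then have "wip S w (T (g + fun_scale t h)) (g + fun_scale t h)
        \<le> c * wip S w (g + fun_scale t h) (g + fun_scale t h)" by (rule quad)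
    moreover have "wip S w (T h) g = wip S w (T g) h"
      using adj[OF h g(1)] by (simp add: wip_commute)
    moreover have "wip S w (T g) h = A + c * wip S w g h"
      unfolding A_def by (subst (2) h_def) (simp add: wip_linear)
    ultimately show ?thesis
      using g(2) wip_commute[of S w h g]
      by (simp add: add scale wip_linear B_def c_def[symmetric] algebra_simps power2_eq_square)
  qed
  have A0: "A \<ge> 0" by (simp add: A_def wip_nonneg)
  have "A = 0"
  proof (rule ccontr)
    assume "A \<noteq> 0"
    define t where "t = A / (\<bar>B\<bar> + 1)"
    have t: "t > 0" "t * \<bar>B\<bar> \<le> A" using A0 \<open>A \<noteq> 0\<close> by (auto simp: t_def field_simps)
    have "t * (2 * A + t * B) \<le> 0" using var[of t] by (simp add: power2_eq_square algebra_simps)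
    then have "2 * A + t * B \<le> 0" using t by (simp add: mult_le_0_iff)
    moreover have "t * B \<ge> - (t * \<bar>B\<bar>)" using t by (simp add: abs_if)
    ultimately show False using t A0 \<open>A \<noteq> 0\<close> by linarith
  qed
  then have "h = 0" using h W(3) wip_self_eq_0_iff by (auto simp: A_def)
  then have "T g = fun_scale c g" by (simp add: h_def)
  moreover have "g \<noteq> 0" using g(2) by auto
  ultimately show ?thesis using that g(1) quad by blast
qed

end

context weighted_set
begin

lemma wip_orthogonal_sum:
  assumes "finite I" and orth: "\<And>i l. i \<in> I \<Longrightarrow> l \<in> I \<Longrightarrow> i \<noteq> l \<Longrightarrow> wip S w (t i) (t l) = 0"
    and i: "i \<in> I"
  shows "wip S w (\<Sum>l\<in>I. fun_scale (a l) (t l)) (t i) = a i * wip S w (t i) (t i)"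
proof -
  have "wip S w (\<Sum>l\<in>I. fun_scale (a l) (t l)) (t i) = (\<Sum>l\<in>I. a l * wip S w (t l) (t i))"
    by (simp add: wip_sum_left wip_linear)
  also have "\<dots> = (\<Sum>l\<in>I. if l = i then a i * wip S w (t i) (t i) else 0)"
    using orth i by (intro sum.cong refl) auto
  finally show ?thesis using assms(1) i by simp
qed

text \<open>The \<open>t i\<close> are orthogonal, and an operator sends \<open>t i\<close> to \<open>b i\<close>, which is nearly \<open>(K - i) t i\<close>; the
  image \<open>\<beta>\<close> of the sum \<open>\<theta>\<close> is orthogonal to all \<open>t i\<close> but the last. Pairing \<open>\<beta>\<close> with \<open>t i\<close> for \<open>i < j\<close>
  shows that \<open>(K - i) |t i|\<close> is at most the total error \<open>|e|\<close>, so that \<open>\<theta>\<close> is nearly \<open>t j\<close>, a near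
  eigenvector for \<open>K - j\<close>. The second claim says that the quadratic form is nearly bounded below by
  the least of the scalars \<open>K - i\<close>, which is at least \<open>1\<close>.\<close>

lemma near_eigenvector_step:
  fixes t b :: "nat \<Rightarrow> 'b \<Rightarrow> real" and K j :: nat and \<epsilon> :: real
  assumes j: "j < K" and \<epsilon>: "0 \<le> \<epsilon>"
    and orth: "\<And>i l. i \<le> j \<Longrightarrow> l \<le> j \<Longrightarrow> i \<noteq> l \<Longrightarrow> wip S w (t i) (t l) = 0"
    and near: "\<And>i. i \<le> j \<Longrightarrow>
      wnorm S w (b i - fun_scale (real K - real i) (t i)) \<le> \<epsilon> * wnorm S w (t i)"
    and \<theta>: "\<theta> = (\<Sum>i\<le>j. t i)" and \<beta>: "\<beta> = (\<Sum>i\<le>j. b i)"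
    and low: "\<And>i. i < j \<Longrightarrow> wip S w \<beta> (t i) = 0"
  shows "wnorm S w (\<beta> - fun_scale (real K - real j) \<theta>) \<le> real K * sqrt (real K) * \<epsilon> * wnorm S w \<theta>"
    and "(1 - \<epsilon> * sqrt (real K)) * wip S w \<theta> \<theta> \<le> wip S w \<beta> \<theta>"
proof -
  let ?N = "wnorm S w"
  define e where "e = \<beta> - (\<Sum>i\<le>j. fun_scale (real K - real i) (t i))"
  have t_dot: "wip S w (\<Sum>l\<le>j. fun_scale (a l) (t l)) (t i) = a i * (?N (t i))\<^sup>2" if "i \<le> j" for a i
    using wip_orthogonal_sum[of "{..j}" t i a] orth that by (simp add: wnorm_power2)
  have \<theta>_dot: "wip S w \<theta> (t i) = (?N (t i))\<^sup>2" if "i \<le> j" for i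
    using t_dot[OF that, of "\<lambda>_. 1"] by (simp add: \<theta>)
  have Pyth: "(?N \<theta>)\<^sup>2 = (\<Sum>i\<le>j. (?N (t i))\<^sup>2)"
  proof -
    have "wip S w \<theta> \<theta> = (\<Sum>i\<le>j. wip S w \<theta> (t i))"
      by (subst (2) \<theta>) (rule wip_sum_right)
    then show ?thesis using \<theta>_dot by (simp add: wnorm_power2)
  qed
  \<comment> \<open>There are \<open>j + 1 \<le> K\<close> components, hence the factor \<open>sqrt K\<close> by Cauchy-Schwarz.\<close>
  have l1: "(\<Sum>i\<le>j. ?N (t i)) \<le> sqrt (real K) * ?N \<theta>"
  proof -
    have "(\<Sum>i\<le>j. ?N (t i))\<^sup>2 \<le> (\<Sum>i\<le>j. (?N (t i))\<^sup>2) * (\<Sum>i\<le>j. 1\<^sup>2)"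
      using Cauchy_Schwarz_ineq_sum[of "\<lambda>i. ?N (t i)" "\<lambda>_. 1" "{..j}"] by simp
    also have "\<dots> \<le> (?N \<theta>)\<^sup>2 * real K"
      using j by (simp add: Pyth[symmetric] mult_left_mono)
    also have "\<dots> = (sqrt (real K) * ?N \<theta>)\<^sup>2" by (simp add: power_mult_distrib)
    finally show ?thesis by (rule power2_le_imp_le) simp
  qed
  have "e = (\<Sum>i\<le>j. b i - fun_scale (real K - real i) (t i))"
    by (simp add: e_def \<beta> sum_subtractf)
  then have "?N e \<le> (\<Sum>i\<le>j. ?N (b i - fun_scale (real K - real i) (t i)))"
    by (simp only: wnorm_sum)
  also have "\<dots> \<le> (\<Sum>i\<le>j. \<epsilon> * ?N (t i))" using near by (intro sum_mono) simp
  also have "\<dots> \<le> \<epsilon> * (sqrt (real K) * ?N \<theta>)"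
    unfolding sum_distrib_left[symmetric] using l1 \<epsilon> by (rule mult_left_mono)
  finally have e_le: "?N e \<le> \<epsilon> * sqrt (real K) * ?N \<theta>" by (simp add: mult_ac)
  have comp: "(real K - real i) * ?N (t i) \<le> ?N e" if i: "i < j" for i
  proof (cases "?N (t i) = 0")
    case False
    have "wip S w e (t i) = - ((real K - real i) * (?N (t i))\<^sup>2)"
      using t_dot[of i "\<lambda>i. real K - real i"] i low by (simp add: e_def wip_linear(3))
    then have "(real K - real i) * ?N (t i) * ?N (t i) \<le> ?N e * ?N (t i)"
      using wip_Cauchy_Schwarz[of e "t i"] by (simp add: power2_eq_square abs_le_iff mult.assoc)
    moreover have "0 < ?N (t i)" using False by (simp add: order_less_le)
    ultimately show ?thesis by simp
  qed simp
  have "\<beta> - fun_scale (real K - real j) \<theta> = e + (\<Sum>i\<le>j. fun_scale (real j - real i) (t i))"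
    by (simp add: fun_eq_iff e_def \<theta> sum_apply sum_distrib_left left_diff_distrib sum_subtractf)
  then have "?N (\<beta> - fun_scale (real K - real j) \<theta>)
      \<le> ?N e + (\<Sum>i\<le>j. ?N (fun_scale (real j - real i) (t i)))"
    using wnorm_triangle[of e] wnorm_sum[of "\<lambda>i. fun_scale (real j - real i) (t i)" "{..j}"]
    by (smt (verit))
  also have "(\<Sum>i\<le>j. ?N (fun_scale (real j - real i) (t i))) \<le> (\<Sum>i<j. ?N e)"
  proof -
    have "(\<Sum>i\<le>j. ?N (fun_scale (real j - real i) (t i)))
        = (\<Sum>i<j. ?N (fun_scale (real j - real i) (t i)))"
      by (simp add: lessThan_Suc_atMost[symmetric] wnorm_scale)
    also have "\<dots> \<le> (\<Sum>i<j. ?N e)"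
    proof (rule sum_mono)
      fix i assume "i \<in> {..<j}"
      then have i: "i < j" by simp
      have "(real j - real i) * ?N (t i) \<le> (real K - real i) * ?N (t i)"
        using j by (intro mult_right_mono) auto
      then show "?N (fun_scale (real j - real i) (t i)) \<le> ?N e"
        using comp[OF i] i by (simp add: wnorm_scale)
    qed
    finally show ?thesis .
  qed
  also have "?N e + (\<Sum>i<j. ?N e) = real (Suc j) * ?N e" by (simp add: algebra_simps)
  also have "\<dots> \<le> real K * ?N e" using j by (intro mult_right_mono) auto
  also have "\<dots> \<le> real K * (\<epsilon> * sqrt (real K) * ?N \<theta>)" using e_le by (intro mult_left_mono) auto
  finally show "?N (\<beta> - fun_scale (real K - real j) \<theta>) \<le> real K * sqrt (real K) * \<epsilon> * ?N \<theta>"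
    by (simp add: mult_ac)
  have "wip S w (\<Sum>i\<le>j. fun_scale (real K - real i) (t i)) \<theta>
      = (\<Sum>i\<le>j. (real K - real i) * (?N (t i))\<^sup>2)"
    by (subst \<theta>) (simp add: wip_sum_right t_dot)
  also have "\<dots> \<ge> (\<Sum>i\<le>j. 1 * (?N (t i))\<^sup>2)"
    using j by (intro sum_mono mult_right_mono) auto
  finally have "(?N \<theta>)\<^sup>2 + wip S w e \<theta> \<le> wip S w \<beta> \<theta>"
    by (simp add: e_def wip_linear(3) Pyth)
  moreover have "\<bar>wip S w e \<theta>\<bar> \<le> \<epsilon> * sqrt (real K) * ?N \<theta> * ?N \<theta>"
    using wip_Cauchy_Schwarz[of e \<theta>] mult_right_mono[OF e_le, of "?N \<theta>"] by simp
  ultimately show "(1 - \<epsilon> * sqrt (real K)) * wip S w \<theta> \<theta> \<le> wip S w \<beta> \<theta>"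
    by (simp add: wnorm_power2[symmetric] power2_eq_square algebra_simps abs_le_iff)
qed

end


section \<open>Walks on weighted graphs with bounded spectrum\<close>

text \<open>The entry with index \<open>1\<close> in decreasing order is the second largest with multiplicity, so two members
  of the multiset that are at least \<open>a\<close>, possibly equal, bound it from below.\<close>

lemma second_largest_ge:
  fixes M :: "real multiset"
  assumes "{#a, b#} \<subseteq># M" "a \<le> b"
  shows "a \<le> rev (sorted_list_of_multiset M) ! 1"
proof (rule ccontr)
  define xs where "xs = rev (sorted_list_of_multiset M)"
  assume "\<not> a \<le> rev (sorted_list_of_multiset M) ! 1"
  then have less: "xs ! 1 < a" by (simp add: xs_def)
  have mset: "mset xs = M" by (simp add: xs_def)
  have "length xs \<ge> 2"
    using size_mset_mono[OF assms(1)] mset by (metis size_mset size_add_mset size_empty numeral_2_eq_2)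
  then obtain x y zs where xs: "xs = x # y # zs"
    by (metis Suc_le_length_iff numeral_2_eq_2)
  have "sorted_wrt (\<ge>) xs"
    unfolding xs_def by (simp add: sorted_wrt_rev)
  then have "filter (\<lambda>z. a \<le> z) (y # zs) = []"
    using less by (auto simp: xs filter_empty_conv)
  then have "size (filter_mset (\<lambda>z. a \<le> z) M) \<le> 1"
    by (auto simp: mset[symmetric] xs simp flip: mset_filter split: if_splits)
  moreover have "filter_mset (\<lambda>z. a \<le> z) {#a, b#} \<subseteq># filter_mset (\<lambda>z. a \<le> z) M"
    using assms(1) by (rule multiset_filter_mono)
  then have "2 \<le> size (filter_mset (\<lambda>z. a \<le> z) M)"
    using size_mset_mono assms(2) by fastforce
  ultimately show False by simp
qed

text \<open>What the walk on the vertices of a link depends on: only vertices and edges, where the weight of a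
  vertex is the total weight of the edges at it.\<close>

locale weighted_graph =
  fixes Y :: "'a set set" and w :: "'a set \<Rightarrow> real"
  assumes finite_vertices: "finite {v. {v} \<in> faces Y 0}"
    and vertex_pos: "{v} \<in> faces Y 0 \<Longrightarrow> 0 < w {v}"
    and edge_vertex: "{v, u} \<in> faces Y 1 \<Longrightarrow> {v} \<in> faces Y 0"
    and edge_nonneg: "{v, u} \<in> faces Y 1 \<Longrightarrow> 0 \<le> w {v, u}"
    and degree: "{v} \<in> faces Y 0 \<Longrightarrow> w {v} = (\<Sum>u | {v, u} \<in> faces Y 1. w {v, u})"
begin

definition V :: "'a set" where "V = {v. {v} \<in> faces Y 0}"

definition deg :: "'a \<Rightarrow> real" where "deg v = w {v}"

text \<open>With the weight extended by \<open>0\<close> to all pairs of vertices, sums over edges become double sums over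
  the vertex set.\<close>

definition ew :: "'a \<Rightarrow> 'a \<Rightarrow> real" where
  "ew v u = (if {v, u} \<in> faces Y 1 then w {v, u} else 0)"

sublocale weighted_set V deg
  by unfold_locales (auto simp: V_def deg_def finite_vertices vertex_pos)

abbreviation walk :: "('a \<Rightarrow> real) \<Rightarrow> 'a \<Rightarrow> real" where "walk \<equiv> graph_walk Y w"

abbreviation one :: "'a \<Rightarrow> real" where "one \<equiv> indicat_real V"

lemma vertex_funs_eq: "vertex_funs Y = supported V"
  by (auto simp: vertex_funs_def supported_def V_def)

lemma ew_commute: "ew v u = ew u v"
  by (simp add: ew_def insert_commute)

lemma ew_nonneg: "0 \<le> ew v u"
  by (simp add: ew_def edge_nonneg)

lemma edge_vertex2: "{v, u} \<in> faces Y 1 \<Longrightarrow> u \<in> V"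
  using edge_vertex[of u v] by (simp add: V_def insert_commute)

lemma sum_edges: "(\<Sum>u | {v, u} \<in> faces Y 1. w {v, u} * f u) = (\<Sum>u\<in>V. ew v u * f u)"
proof -
  have "(\<Sum>u\<in>V. ew v u * f u) = (\<Sum>u\<in>V. if {v, u} \<in> faces Y 1 then w {v, u} * f u else 0)"
    by (intro sum.cong refl) (simp add: ew_def)
  also have "\<dots> = (\<Sum>u\<in>{u\<in>V. {v, u} \<in> faces Y 1}. w {v, u} * f u)"
    using finite_S by (simp add: sum.inter_filter)
  also have "{u\<in>V. {v, u} \<in> faces Y 1} = {u. {v, u} \<in> faces Y 1}"
    using edge_vertex2 by blast
  finally show ?thesis by simp
qed

lemma degree_ew: "v \<in> V \<Longrightarrow> deg v = (\<Sum>u\<in>V. ew v u)"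
  using sum_edges[of v "\<lambda>_. 1"] degree[of v] by (simp add: V_def deg_def)

lemma walk_eq: "walk f v = (if v \<in> V then (\<Sum>u\<in>V. ew v u * f u) / deg v else 0)"
  using sum_edges[of v f, symmetric] by (simp add: graph_walk_def V_def deg_def sum_divide_distrib)

lemma walk_supported: "walk f \<in> supported V"
  by (simp add: supported_def walk_eq)

lemma walk_add: "walk (f + g) = walk f + walk g"
  by (simp add: fun_eq_iff walk_eq sum.distrib distrib_left add_divide_distrib)

lemma walk_scale: "walk (fun_scale c f) = fun_scale c (walk f)"
  by (simp add: fun_eq_iff walk_eq sum_distrib_left mult.left_commute)

lemma wip_walk: "wip V deg (walk f) g = (\<Sum>v\<in>V. \<Sum>u\<in>V. ew v u * f u * g v)"
proof -
  have "deg v * walk f v * g v = (\<Sum>u\<in>V. ew v u * f u * g v)" if "v \<in> V" for v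
    using w_pos[OF that] that by (simp add: walk_eq sum_distrib_right)
  then show ?thesis by (simp add: wip_def)
qed

lemma walk_selfadjoint: "wip V deg (walk f) g = wip V deg f (walk g)"
proof -
  have "wip V deg (walk f) g = (\<Sum>u\<in>V. \<Sum>v\<in>V. ew v u * f u * g v)"
    unfolding wip_walk by (rule sum.swap)
  also have "\<dots> = wip V deg (walk g) f"
    unfolding wip_walk by (intro sum.cong refl) (simp add: ew_commute mult_ac)
  finally show ?thesis by (simp add: wip_commute)
qed

lemma one_supported: "one \<in> supported V"
  by (simp add: supported_def)

lemma walk_one: "walk one = one"
proof
  fix v show "walk one v = one v"
    using w_pos[of v] degree_ew[of v, symmetric] by (cases "v \<in> V") (auto simp: walk_eq)
qed

text \<open>Sum \<open>2 f u f v \<le> (f u)\<^sup>2 + (f v)\<^sup>2\<close> over the edges.\<close>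

lemma Rayleigh_le_1: "wip V deg (walk f) f \<le> wip V deg f f"
proof -
  have half: "(\<Sum>v\<in>V. \<Sum>u\<in>V. ew v u * (f v)\<^sup>2) = wip V deg f f"
  proof -
    have "(\<Sum>u\<in>V. ew v u * (f v)\<^sup>2) = deg v * f v * f v" if "v \<in> V" for v
      using degree_ew[OF that] by (simp add: sum_distrib_right power2_eq_square mult.assoc)
    then show ?thesis by (simp add: wip_def)
  qed
  have half': "(\<Sum>v\<in>V. \<Sum>u\<in>V. ew v u * (f u)\<^sup>2) = wip V deg f f"
    by (subst sum.swap) (simp add: ew_commute flip: half)
  have "2 * wip V deg (walk f) f \<le> (\<Sum>v\<in>V. \<Sum>u\<in>V. ew v u * (f v)\<^sup>2 + ew v u * (f u)\<^sup>2)"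
    unfolding wip_walk sum_distrib_left
  proof (intro sum_mono)
    fix v u
    have "0 \<le> ew v u * (f u - f v)\<^sup>2" by (simp add: ew_nonneg)
    then show "2 * (ew v u * f u * f v) \<le> ew v u * (f v)\<^sup>2 + ew v u * (f u)\<^sup>2"
      by (simp add: power2_eq_square algebra_simps)
  qed
  also have "\<dots> = 2 * wip V deg f f" by (simp add: sum.distrib half half')
  finally show ?thesis by simp
qed

lemma continuous_walk: "continuous_on UNIV (\<lambda>f. walk f v)"
  using w_pos[of v] by (cases "v \<in> V") (auto simp: walk_eq intro!: continuous_intros)

lemma eigenspace_eq: "walk_eigenspace Y w c = {f \<in> supported V. walk f = fun_scale c f}"
  by (simp add: walk_eigenspace_def vertex_funs_eq fun_scale_def)

lemma eigenvectors_orthogonal: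
  assumes "walk f = fun_scale a f" "walk g = fun_scale b g" "a \<noteq> b"
  shows "wip V deg f g = 0"
proof -
  have "a * wip V deg f g = b * wip V deg f g"
    using walk_selfadjoint[of f g] assms(1,2) by (simp add: wip_linear)
  then show ?thesis using assms(3) by simp
qed

text \<open>Without finiteness the sum that defines the spectrum and the minimum that defines the smallest
  eigenvalue would be junk values. Eigenvectors of distinct eigenvalues are orthogonal, hence independent.\<close>

lemma finite_eigenvalues: "finite (walk_eigenvalues Y w)"
proof -
  have "\<forall>c\<in>walk_eigenvalues Y w. \<exists>f. f \<in> walk_eigenspace Y w c \<and> f \<noteq> 0"
    by (auto simp: walk_eigenvalues_def)
  then obtain F where F: "\<And>c. c \<in> walk_eigenvalues Y w \<Longrightarrow> F c \<in> walk_eigenspace Y w c \<and> F c \<noteq> 0"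
    by metis
  have orth: "wip V deg (F a) (F b) = 0"
    if "a \<in> walk_eigenvalues Y w" "b \<in> walk_eigenvalues Y w" "a \<noteq> b" for a b
    using F[OF that(1)] F[OF that(2)] that(3) eigenvectors_orthogonal by (auto simp: eigenspace_eq)
  have inj: "inj_on F (walk_eigenvalues Y w)"
  proof (rule inj_onI, rule ccontr)
    fix a b assume *: "a \<in> walk_eigenvalues Y w" "b \<in> walk_eigenvalues Y w" "F a = F b" "a \<noteq> b"
    then have "wip V deg (F a) (F a) = 0" using orth by metis
    then show False using F[OF *(1)] wip_self_eq_0_iff by (simp add: eigenspace_eq)
  qed
  have "F ` walk_eigenvalues Y w \<subseteq> supported V" using F by (auto simp: eigenspace_eq)
  moreover have "fs.independent (F ` walk_eigenvalues Y w)"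
    using F orth by (intro independent_orthogonal) (force simp: eigenspace_eq)+
  ultimately show ?thesis using finite_independent_supported inj finite_imageD by blast
qed

lemma count_walk_spectrum:
  assumes "c \<in> walk_eigenvalues Y w"
  shows "count (walk_spectrum Y w) c = fs.dim (walk_eigenspace Y w c)"
  using assms finite_eigenvalues unfolding walk_spectrum_def
  by (simp add: count_sum sum.delta')

text \<open>The constants have eigenvalue \<open>1\<close>, the largest possible. So \<open>c\<close> and \<open>1\<close> both occur in the
  spectrum; if \<open>c = 1\<close> then \<open>1\<close> occurs twice, because \<open>g\<close> and the constants span a plane.\<close>

lemma orthogonal_eigenvector_le_second_largest:
  assumes g: "g \<in> supported V" "g \<noteq> 0" "walk g = fun_scale c g" and orth: "wip V deg g one = 0"
  shows "c \<le> second_largest_eigenvalue Y w"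
proof -
  have gg: "0 < wip V deg g g"
    using g wip_nonneg wip_self_eq_0_iff by (metis order_less_le)
  have c1: "c \<le> 1"
    using Rayleigh_le_1[of g] gg by (simp add: g(3) wip_linear)
  have one_nz: "one \<noteq> 0"
  proof
    assume "one = 0"
    then have "v \<notin> V" for v by (metis indicator_simps(1) zero_fun_apply zero_neq_one)
    then have "V = {}" by blast
    then show False using gg by (simp add: wip_def)
  qed
  have one_in: "one \<in> walk_eigenspace Y w 1"
    by (simp add: eigenspace_eq one_supported walk_one)
  have g_in: "g \<in> walk_eigenspace Y w c" using g by (simp add: eigenspace_eq)
  have ev: "1 \<in> walk_eigenvalues Y w" "c \<in> walk_eigenvalues Y w"
    using one_in one_nz g_in g(2) by (auto simp: walk_eigenvalues_def)
  have dim_ge: "card A \<le> fs.dim (walk_eigenspace Y w b)"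
    if "A \<subseteq> walk_eigenspace Y w b" "A \<subseteq> {one, g}" for A b
  proof (rule card_le_dim_supported)
    have "wip V deg one g = 0" using orth by (simp add: wip_commute)
    then show "fs.independent A"
      using that(2) one_supported g(1,2) one_nz orth by (intro independent_orthogonal) auto
  qed (use that in \<open>auto simp: eigenspace_eq\<close>)
  have "{#c, 1#} \<subseteq># walk_spectrum Y w"
  proof (cases "c = 1")
    case True
    have "g \<noteq> one" using orth gg by auto
    then have "2 \<le> fs.dim (walk_eigenspace Y w 1)"
      using dim_ge[of "{one, g}" 1] one_in g_in True by simp
    then show ?thesis
      using True count_walk_spectrum[OF ev(1)] by (auto simp: subseteq_mset_def)
  next
    case False
    have "1 \<le> count (walk_spectrum Y w) 1" "1 \<le> count (walk_spectrum Y w) c"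
      using dim_ge[of "{one}" 1] dim_ge[of "{g}" c] one_in g_in
      by (simp_all add: count_walk_spectrum ev)
    then show ?thesis using False by (auto simp: subseteq_mset_def)
  qed
  then show ?thesis
    unfolding second_largest_eigenvalue_def using c1 by (rule second_largest_ge)
qed

text \<open>The walk preserves the orthogonal complement of the constants. A Rayleigh maximizer there has an
  eigenvalue at most \<open>lam\<close>; a maximizer for the negated walk bounds the form from below through the
  smallest eigenvalue.\<close>

lemma expander_form_bound:
  assumes "- lam \<le> smallest_eigenvalue Y w" "second_largest_eigenvalue Y w \<le> lam"
    and f: "f \<in> supported V" "wip V deg f one = 0"
  shows "\<bar>wip V deg (walk f) f\<bar> \<le> lam * wip V deg f f"
proof (cases "f = 0")
  case False
  define W where "W = {f \<in> supported V. wip V deg f one = 0}"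
  have W: "fs.subspace W" "W \<subseteq> supported V"
    using fs.subspace_add[OF subspace_supported] fs.subspace_scale[OF subspace_supported]
    by (auto simp: fs.subspace_def W_def supported_def wip_linear)
  have "closed W"
  proof -
    have "W = (\<Inter>x\<in>-V. {f. f x = 0}) \<inter> {f. wip V deg f one = 0}"
      by (auto simp: W_def supported_def)
    moreover have "closed {f::'a \<Rightarrow> real. f x = 0}" for x
      by (intro closed_Collect_eq) auto
    moreover have "closed {f. wip V deg f one = 0}"
      by (intro closed_Collect_eq continuous_wip) auto
    ultimately show ?thesis by auto
  qed
  have f_in: "f \<in> W" using f by (simp add: W_def)
  have nz: "W \<noteq> {0}" using f_in False by blast
  have walk_W: "walk g \<in> W" if "g \<in> W" for g
    using that walk_supported walk_selfadjoint[of g one] by (simp add: W_def walk_one)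
  have walk_cont: "continuous_on UNIV (\<lambda>f. wip V deg (walk f) f)"
    by (intro continuous_wip continuous_walk) auto
  obtain g c where g: "g \<in> W" "g \<noteq> 0" "walk g = fun_scale c g"
    and max: "\<And>f. f \<in> W \<Longrightarrow> wip V deg (walk f) f \<le> c * wip V deg f f"
    using Rayleigh_maximizer[OF W(1) \<open>closed W\<close> W(2) nz walk_W walk_add walk_scale
      walk_selfadjoint walk_cont] by metis
  have "c \<le> lam"
    using orthogonal_eigenvector_le_second_largest[of g c] g assms(2) by (auto simp: W_def)
  then have upper: "wip V deg (walk f) f \<le> lam * wip V deg f f"
    using max[OF f_in] wip_nonneg[of f] by (meson mult_right_mono order_trans)
  define T where "T f = fun_scale (-1) (walk f)" for f
  have T_cont: "continuous_on UNIV (\<lambda>f. wip V deg (T f) f)"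
    unfolding T_def by (intro continuous_wip) (auto intro!: continuous_intros continuous_walk)
  have T_W: "T h \<in> W" if "h \<in> W" for h
    unfolding T_def using W(1) walk_W[OF that] by (rule fs.subspace_scale)
  have T_add: "T (h + k) = T h + T k" and T_scale: "T (fun_scale a h) = fun_scale a (T h)" for h k a
    by (simp_all add: T_def walk_add walk_scale fun_eq_iff)
  have T_adj: "wip V deg (T h) k = wip V deg h (T k)" for h k
    unfolding T_def wip_linear(5,6) by (simp only: walk_selfadjoint)
  obtain h b where h: "h \<in> W" "h \<noteq> 0" "T h = fun_scale b h"
    and min: "\<And>f. f \<in> W \<Longrightarrow> wip V deg (T f) f \<le> b * wip V deg f f"
    using Rayleigh_maximizer[OF W(1) \<open>closed W\<close> W(2) nz T_W T_add T_scale T_adj T_cont] by metis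
  have "walk h = fun_scale (-1) (T h)" by (simp add: T_def fun_eq_iff)
  then have "walk h = fun_scale (-b) h" by (simp add: h(3) fun_eq_iff)
  then have "- b \<in> walk_eigenvalues Y w"
    using h by (auto simp: walk_eigenvalues_def eigenspace_eq W_def)
  then have "smallest_eigenvalue Y w \<le> - b"
    unfolding smallest_eigenvalue_def using finite_eigenvalues by (rule Min_le[rotated])
  then have "b \<le> lam" using assms(1) by linarith
  then have "- wip V deg (walk f) f \<le> lam * wip V deg f f"
    using min[OF f_in] wip_nonneg[of f] mult_right_mono[of b lam "wip V deg f f"]
    unfolding T_def wip_linear(5) by simp
  then show ?thesis using upper by (simp add: abs_le_iff)
qed simp

text \<open>Two vertices make room for a nonzero function orthogonal to the constants, on which the two-sided
  bound has to hold.\<close>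

lemma expander_parameter_nonneg:
  assumes "- lam \<le> smallest_eigenvalue Y w" "second_largest_eigenvalue Y w \<le> lam"
    and vu: "u \<in> V" "v \<in> V" "u \<noteq> v"
  shows "0 \<le> lam"
proof -
  define f where "f x = (if x = u then 1 / deg u else if x = v then - 1 / deg v else 0)" for x
  have f: "f \<in> supported V" using vu by (auto simp: f_def supported_def)
  have "wip V deg f one = (\<Sum>x\<in>{u, v}. deg x * f x)"
    unfolding wip_def using vu finite_S by (intro sum.mono_neutral_cong_right) (auto simp: f_def)
  also have "\<dots> = 0" using vu w_pos[of u] w_pos[of v] by (simp add: f_def)
  finally have orth: "wip V deg f one = 0" .
  have "f u \<noteq> 0" using w_pos[OF vu(1)] by (simp add: f_def)
  then have "f \<noteq> 0" by auto
  then have "0 < wip V deg f f"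
    using wip_self_eq_0_iff[OF f] wip_nonneg[of f] by (simp add: order_less_le)
  moreover have "0 \<le> lam * wip V deg f f"
    using expander_form_bound[OF assms(1,2) f orth] by linarith
  ultimately show ?thesis by (simp add: zero_le_mult_iff)
qed

text \<open>The walk fixes constants, so subtracting from \<open>g\<close> its mean removes from the form of the walk exactly
  the form of the projection to constants.\<close>

lemma expander_walk_near_mean:
  assumes "- lam \<le> smallest_eigenvalue Y w" "second_largest_eigenvalue Y w \<le> lam" and "0 \<le> lam"
    and g: "g \<in> supported V"
  shows "\<bar>wip V deg (walk g) g - (wip V deg g one)\<^sup>2 / (\<Sum>v\<in>V. deg v)\<bar> \<le> lam * wip V deg g g"
proof (cases "V = {}")
  case False
  define D where "D = (\<Sum>v\<in>V. deg v)"
  have D: "0 < D" unfolding D_def using finite_S False w_pos by (rule sum_pos)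
  have DD: "wip V deg one one = D" by (simp add: wip_def D_def)
  define a where "a = wip V deg g one / D"
  have ga: "wip V deg g one = a * D" "wip V deg one g = a * D"
    using D by (simp_all add: a_def wip_commute[of V deg one])
  define f where "f = g - fun_scale a one"
  have f: "f \<in> supported V"
    unfolding f_def using g one_supported subspace_supported
    by (intro fs.subspace_diff fs.subspace_scale)
  have orth: "wip V deg f one = 0" by (simp add: f_def wip_linear DD ga)
  have walk_f: "walk f = walk g - fun_scale a one"
    using walk_add[of f "fun_scale a one"] by (simp add: walk_scale walk_one f_def)
  have "wip V deg (walk g) one = a * D"
    by (simp add: walk_selfadjoint walk_one ga)
  then have form: "wip V deg (walk f) f = wip V deg (walk g) g - a\<^sup>2 * D"
    unfolding walk_f by (simp add: f_def wip_linear DD ga power2_eq_square algebra_simps)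
  have norm: "wip V deg f f = wip V deg g g - a\<^sup>2 * D"
    by (simp add: f_def wip_linear DD ga power2_eq_square algebra_simps)
  have "\<bar>wip V deg (walk g) g - a\<^sup>2 * D\<bar> \<le> lam * (wip V deg g g - a\<^sup>2 * D)"
    using expander_form_bound[OF assms(1,2) f orth] by (simp only: form norm)
  also have "\<dots> \<le> lam * wip V deg g g"
    using D assms(3) by (intro mult_left_mono) auto
  also have "a\<^sup>2 * D = (wip V deg g one)\<^sup>2 / D"
    using D by (simp add: a_def power2_eq_square)
  finally show ?thesis by (simp add: D_def)
qed (simp add: wip_def)

end


section \<open>Weighted complexes and the differential\<close>

locale weighted_complex =
  fixes X :: "'a set set" and n :: nat and m :: "'a set \<Rightarrow> real"
  assumes pure: "pure_complex X n" and weight: "weight_function X n m"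
begin

text \<open>Simplices are graded by the number of vertices, one more than the dimension. Degrees are then natural
  numbers, and the empty simplex and the differential out of it need no special treatment.\<close>

definition level :: "nat \<Rightarrow> 'a set set" where "level c = {\<sigma> \<in> X. card \<sigma> = c}"

lemma faces_level:
  "faces X (int k) = level (Suc k)" "faces X (int k + 1) = level (Suc (Suc k))"
  "faces X (int k - 1) = level k"
  by (auto simp: faces_def level_def)

lemma finite_X: "finite X" and finite_simplex: "\<sigma> \<in> X \<Longrightarrow> finite \<sigma>"
  and face_closed: "\<sigma> \<in> X \<Longrightarrow> \<tau> \<subseteq> \<sigma> \<Longrightarrow> \<tau> \<in> X"
  using pure by (auto simp: pure_complex_def simplicial_complex_def)

lemma empty_in_X: "{} \<in> X"
  using pure by (auto simp: pure_complex_def simplicial_complex_def)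

lemma facet_exists:
  assumes "\<tau> \<in> X" obtains \<sigma> where "\<sigma> \<in> X" "card \<sigma> = Suc n" "\<tau> \<subseteq> \<sigma>"
  using assms pure by (fastforce simp: pure_complex_def faces_def)

lemma finite_level: "finite (level c)"
  unfolding level_def by (rule finite_subset[OF _ finite_X]) auto

lemma card_le: "\<sigma> \<in> X \<Longrightarrow> card \<sigma> \<le> Suc n"
  using facet_exists by (metis card_mono finite_simplex)

lemma weight_pos: "\<sigma> \<in> X \<Longrightarrow> 0 < m \<sigma>"
proof -
  assume \<sigma>: "\<sigma> \<in> X"
  then have "\<sigma> \<in> faces X (int (card \<sigma>) - 1)" by (simp add: faces_def)
  moreover have "-1 \<le> int (card \<sigma>) - 1" "int (card \<sigma>) - 1 \<le> int n"
    using card_le[OF \<sigma>] by auto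
  ultimately show ?thesis using weight unfolding weight_function_def by blast
qed

lemma weight_sum:
  assumes "\<tau> \<in> level c" "c \<le> n"
  shows "m \<tau> = (\<Sum>\<sigma> | \<sigma> \<in> level (Suc c) \<and> \<tau> \<subset> \<sigma>. m \<sigma>)"
proof -
  have "-1 \<le> int c - 1 \<and> int c - 1 \<le> int n - 1" using assms(2) by simp
  moreover have "\<tau> \<in> faces X (int c - 1)" using assms(1) by (simp add: faces_level)
  ultimately have "m \<tau> = (\<Sum>\<sigma> | \<sigma> \<in> faces X (int c - 1 + 1) \<and> \<tau> \<subset> \<sigma>. m \<sigma>)"
    using weight unfolding weight_function_def by blast
  then show ?thesis by (simp add: faces_level)
qed

lemma weighted_set_level: "weighted_set (level c) m"
  by (intro weighted_set.intro finite_level) (simp add: level_def weight_pos)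

interpretation L: weighted_set "level c" m for c
  by (rule weighted_set_level)

abbreviation ip :: "nat \<Rightarrow> ('a set \<Rightarrow> real) \<Rightarrow> ('a set \<Rightarrow> real) \<Rightarrow> real" where
  "ip c \<equiv> wip (level c) m"

abbreviation nm :: "nat \<Rightarrow> ('a set \<Rightarrow> real) \<Rightarrow> real" where
  "nm c \<equiv> wnorm (level c) m"

text \<open>\<open>cobd (Suc k)\<close> is \<open>sdiff X k\<close>, and \<open>cobd 0\<close> is the differential out of the empty simplex;
  \<open>cobd_adj c\<close> is the explicit form of the adjoint, the weighted average over the cofaces.\<close>

definition cobd :: "nat \<Rightarrow> ('a set \<Rightarrow> real) \<Rightarrow> 'a set \<Rightarrow> real" where
  "cobd c \<phi> = (\<lambda>\<sigma>. if \<sigma> \<in> level (Suc c) then (\<Sum>\<tau> | \<tau> \<in> level c \<and> \<tau> \<subset> \<sigma>. \<phi> \<tau>) else 0)"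

definition cobd_adj :: "nat \<Rightarrow> ('a set \<Rightarrow> real) \<Rightarrow> 'a set \<Rightarrow> real" where
  "cobd_adj c \<psi> = (\<lambda>\<tau>. if \<tau> \<in> level c
     then (\<Sum>\<sigma> | \<sigma> \<in> level (Suc c) \<and> \<tau> \<subset> \<sigma>. m \<sigma> / m \<tau> * \<psi> \<sigma>) else 0)"

lemma cobd_supported: "cobd c \<phi> \<in> supported (level (Suc c))"
  by (simp add: cobd_def supported_def)

lemma cobd_adj_supported: "cobd_adj c \<psi> \<in> supported (level c)"
  by (simp add: cobd_adj_def supported_def)

lemma cobd_linear:
  "cobd c (f + g) = cobd c f + cobd c g" "cobd c (f - g) = cobd c f - cobd c g"
  "cobd c (fun_scale a f) = fun_scale a (cobd c f)"
  by (auto simp: cobd_def fun_eq_iff sum.distrib sum_subtractf sum_distrib_left)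

lemma cobd_adj_linear:
  "cobd_adj c (f + g) = cobd_adj c f + cobd_adj c g" "cobd_adj c (f - g) = cobd_adj c f - cobd_adj c g"
  "cobd_adj c (fun_scale a f) = fun_scale a (cobd_adj c f)"
  by (auto simp: cobd_adj_def fun_eq_iff sum.distrib sum_subtractf sum_distrib_left distrib_left
      right_diff_distrib mult.left_commute)

lemma cobd_zero: "cobd c 0 = 0"
  by (simp add: cobd_def fun_eq_iff)

lemma cobd_sum: "cobd c (\<Sum>i\<in>I. f i) = (\<Sum>i\<in>I. cobd c (f i))"
proof
  fix \<sigma> show "cobd c (\<Sum>i\<in>I. f i) \<sigma> = (\<Sum>i\<in>I. cobd c (f i)) \<sigma>"
    using sum.swap[of "\<lambda>\<tau> i. f i \<tau>" I "{\<tau> \<in> level c. \<tau> \<subset> \<sigma>}"] by (simp add: cobd_def sum_apply)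
qed

lemma cobd_adj_sum: "cobd_adj c (\<Sum>i\<in>I. f i) = (\<Sum>i\<in>I. cobd_adj c (f i))"
proof
  fix \<tau> show "cobd_adj c (\<Sum>i\<in>I. f i) \<tau> = (\<Sum>i\<in>I. cobd_adj c (f i)) \<tau>"
    using sum.swap[of "\<lambda>\<sigma> i. m \<sigma> / m \<tau> * f i \<sigma>" I "{\<sigma> \<in> level (Suc c). \<tau> \<subset> \<sigma>}"]
    by (simp add: cobd_adj_def sum_apply sum_distrib_left)
qed

lemma cobd_adjoint: "ip (Suc c) (cobd c \<phi>) \<psi> = ip c \<phi> (cobd_adj c \<psi>)"
proof -
  have "ip (Suc c) (cobd c \<phi>) \<psi>
      = (\<Sum>\<sigma>\<in>level (Suc c). \<Sum>\<tau> | \<tau> \<in> level c \<and> \<tau> \<subset> \<sigma>. m \<sigma> * \<phi> \<tau> * \<psi> \<sigma>)"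
    by (simp add: wip_def cobd_def sum_distrib_left sum_distrib_right)
  also have "\<dots> = (\<Sum>\<tau>\<in>level c. \<Sum>\<sigma> | \<sigma> \<in> level (Suc c) \<and> \<tau> \<subset> \<sigma>. m \<sigma> * \<phi> \<tau> * \<psi> \<sigma>)"
    by (rule sum.swap_restrict[OF finite_level finite_level])
  also have "\<dots> = ip c \<phi> (cobd_adj c \<psi>)"
    unfolding wip_def
  proof (intro sum.cong refl)
    fix \<tau> assume \<tau>: "\<tau> \<in> level c"
    then have "m \<tau> \<noteq> 0" using weight_pos by (force simp: level_def)
    then show "(\<Sum>\<sigma> | \<sigma> \<in> level (Suc c) \<and> \<tau> \<subset> \<sigma>. m \<sigma> * \<phi> \<tau> * \<psi> \<sigma>) = m \<tau> * \<phi> \<tau> * cobd_adj c \<psi> \<tau>"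
      using \<tau> by (simp add: cobd_adj_def sum_distrib_left mult_ac)
  qed
  finally show ?thesis .
qed

lemma card_facets:
  assumes "\<sigma> \<in> level (Suc c)"
  shows "card {\<tau>. \<tau> \<in> level c \<and> \<tau> \<subset> \<sigma>} = Suc c"
proof -
  have \<sigma>: "\<sigma> \<in> X" "card \<sigma> = Suc c" "finite \<sigma>"
    using assms finite_simplex by (auto simp: level_def)
  have "{\<tau>. \<tau> \<in> level c \<and> \<tau> \<subset> \<sigma>} = {\<tau>. \<tau> \<subseteq> \<sigma> \<and> card \<tau> = c}"
    using \<sigma> face_closed by (auto simp: level_def)
  then show ?thesis using n_subsets[OF \<sigma>(3), of c] \<sigma>(2) by simp
qed

lemma sum_over_facets:
  "(\<Sum>\<tau>\<in>level c. \<Sum>\<sigma> | \<sigma> \<in> level (Suc c) \<and> \<tau> \<subset> \<sigma>. F \<sigma>) = real (Suc c) * (\<Sum>\<sigma>\<in>level (Suc c). F \<sigma>)"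
proof -
  have "(\<Sum>\<tau>\<in>level c. \<Sum>\<sigma> | \<sigma> \<in> level (Suc c) \<and> \<tau> \<subset> \<sigma>. F \<sigma>)
      = (\<Sum>\<sigma>\<in>level (Suc c). \<Sum>\<tau> | \<tau> \<in> level c \<and> \<tau> \<subset> \<sigma>. F \<sigma>)"
    by (rule sum.swap_restrict[OF finite_level finite_level])
  also have "\<dots> = (\<Sum>\<sigma>\<in>level (Suc c). real (Suc c) * F \<sigma>)"
    by (intro sum.cong refl) (simp add: card_facets)
  finally show ?thesis by (simp add: sum_distrib_left)
qed

lemma cobd_norm_le:
  assumes "c \<le> n"
  shows "nm (Suc c) (cobd c \<phi>) \<le> sqrt (real (Suc c)) * nm c \<phi>"
proof -
  have "ip (Suc c) (cobd c \<phi>) (cobd c \<phi>)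
      \<le> (\<Sum>\<sigma>\<in>level (Suc c). \<Sum>\<tau> | \<tau> \<in> level c \<and> \<tau> \<subset> \<sigma>. real (Suc c) * (m \<sigma> * (\<phi> \<tau>)\<^sup>2))"
    unfolding wip_def
  proof (rule sum_mono)
    fix \<sigma> assume \<sigma>: "\<sigma> \<in> level (Suc c)"
    let ?A = "{\<tau>. \<tau> \<in> level c \<and> \<tau> \<subset> \<sigma>}"
    have "(\<Sum>\<tau>\<in>?A. \<phi> \<tau>)\<^sup>2 \<le> real (Suc c) * (\<Sum>\<tau>\<in>?A. (\<phi> \<tau>)\<^sup>2)"
      using Cauchy_Schwarz_ineq_sum[of \<phi> "\<lambda>_. 1" ?A] card_facets[OF \<sigma>] by (simp add: mult.commute)
    then have "m \<sigma> * (\<Sum>\<tau>\<in>?A. \<phi> \<tau>)\<^sup>2 \<le> m \<sigma> * (real (Suc c) * (\<Sum>\<tau>\<in>?A. (\<phi> \<tau>)\<^sup>2))"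
      using L.w_pos[OF \<sigma>] by (intro mult_left_mono) auto
    then show "m \<sigma> * cobd c \<phi> \<sigma> * cobd c \<phi> \<sigma> \<le> (\<Sum>\<tau>\<in>?A. real (Suc c) * (m \<sigma> * (\<phi> \<tau>)\<^sup>2))"
      using \<sigma> by (simp add: cobd_def power2_eq_square sum_distrib_left mult_ac)
  qed
  also have "\<dots> = (\<Sum>\<tau>\<in>level c. \<Sum>\<sigma> | \<sigma> \<in> level (Suc c) \<and> \<tau> \<subset> \<sigma>. real (Suc c) * (m \<sigma> * (\<phi> \<tau>)\<^sup>2))"
    by (rule sum.swap_restrict[OF finite_level finite_level])
  also have "\<dots> = (\<Sum>\<tau>\<in>level c. real (Suc c) * (m \<tau> * (\<phi> \<tau>)\<^sup>2))"
    using assms by (intro sum.cong refl) (simp add: weight_sum sum_distrib_left sum_distrib_right)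
  also have "\<dots> = real (Suc c) * ip c \<phi> \<phi>"
    by (simp add: wip_def sum_distrib_left power2_eq_square mult_ac)
  finally show ?thesis
    unfolding wnorm_def by (metis real_sqrt_le_iff real_sqrt_mult)
qed

text \<open>Two distinct simplices with \<open>c\<close> vertices have at most one common coface with \<open>c + 1\<close> vertices, their
  union. This identifies \<open>d\<^sup>* d\<close> with the upper walk up to a factor.\<close>

lemma cobd_adj_cobd_eq:
  assumes \<tau>: "\<tau> \<in> level c" and c: "c \<le> n"
  shows "cobd_adj c (cobd c \<phi>) \<tau> = \<phi> \<tau> +
    (\<Sum>\<tau>' | \<tau>' \<in> level c \<and> \<tau>' \<noteq> \<tau> \<and> \<tau> \<union> \<tau>' \<in> level (Suc c). m (\<tau> \<union> \<tau>') / m \<tau> * \<phi> \<tau>')"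
proof -
  have m0: "m \<tau> > 0" using L.w_pos[OF \<tau>] .
  let ?C = "{\<sigma> \<in> level (Suc c). \<tau> \<subset> \<sigma>}"
  define G where "G \<tau>' = (\<Sum>\<sigma> | \<sigma> \<in> ?C \<and> \<tau>' \<subset> \<sigma>. m \<sigma> / m \<tau> * \<phi> \<tau>')" for \<tau>'
  have "cobd_adj c (cobd c \<phi>) \<tau> = (\<Sum>\<sigma>\<in>?C. \<Sum>\<tau>' | \<tau>' \<in> level c \<and> \<tau>' \<subset> \<sigma>. m \<sigma> / m \<tau> * \<phi> \<tau>')"
    using \<tau> by (simp add: cobd_adj_def cobd_def sum_distrib_left)
  also have "\<dots> = (\<Sum>\<tau>'\<in>level c. G \<tau>')"
    unfolding G_def using finite_level by (intro sum.swap_restrict) auto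
  also have "\<dots> = G \<tau> + (\<Sum>\<tau>'\<in>level c - {\<tau>}. G \<tau>')"
    using \<tau> finite_level by (simp add: sum.remove)
  also have "G \<tau> = \<phi> \<tau>"
  proof -
    have "G \<tau> = (\<Sum>\<sigma> | \<sigma> \<in> level (Suc c) \<and> \<tau> \<subset> \<sigma>. m \<sigma>) / m \<tau> * \<phi> \<tau>"
      unfolding G_def sum_divide_distrib sum_distrib_right by (intro sum.cong) auto
    then show ?thesis using m0 by (simp add: weight_sum[OF \<tau> c, symmetric])
  qed
  also have "(\<Sum>\<tau>'\<in>level c - {\<tau>}. G \<tau>')
      = (\<Sum>\<tau>'\<in>level c - {\<tau>}. if \<tau> \<union> \<tau>' \<in> level (Suc c) then m (\<tau> \<union> \<tau>') / m \<tau> * \<phi> \<tau>' else 0)"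
  proof (intro sum.cong refl)
    fix \<tau>' assume \<tau>': "\<tau>' \<in> level c - {\<tau>}"
    have fin: "finite \<tau>" "finite \<tau>'" and cards: "card \<tau> = c" "card \<tau>' = c"
      using \<tau> \<tau>' finite_simplex by (auto simp: level_def)
    have ne: "\<not> \<tau>' \<subseteq> \<tau>" "\<not> \<tau> \<subseteq> \<tau>'"
      using card_subset_eq[OF fin(1), of \<tau>'] card_subset_eq[OF fin(2), of \<tau>] cards \<tau>' by auto
    then have "card \<tau> < card (\<tau> \<union> \<tau>')"
      using fin by (intro psubset_card_mono) auto
    then have "\<sigma> = \<tau> \<union> \<tau>'" if "\<sigma> \<in> level (Suc c)" "\<tau> \<subset> \<sigma>" "\<tau>' \<subset> \<sigma>" for \<sigma>
      using that cards finite_simplex by (intro card_seteq[symmetric]) (auto simp: level_def)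
    then have "{\<sigma>. \<sigma> \<in> ?C \<and> \<tau>' \<subset> \<sigma>} = (if \<tau> \<union> \<tau>' \<in> level (Suc c) then {\<tau> \<union> \<tau>'} else {})"
      using ne by auto
    then show "G \<tau>' = (if \<tau> \<union> \<tau>' \<in> level (Suc c) then m (\<tau> \<union> \<tau>') / m \<tau> * \<phi> \<tau>' else 0)"
      by (simp add: G_def)
  qed
  also have "\<dots> = (\<Sum>\<tau>'\<in>{\<tau>' \<in> level c - {\<tau>}. \<tau> \<union> \<tau>' \<in> level (Suc c)}. m (\<tau> \<union> \<tau>') / m \<tau> * \<phi> \<tau>')"
    by (rule sum.inter_filter[symmetric]) (simp add: finite_level)
  also have "{\<tau>' \<in> level c - {\<tau>}. \<tau> \<union> \<tau>' \<in> level (Suc c)}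
      = {\<tau>'. \<tau>' \<in> level c \<and> \<tau>' \<noteq> \<tau> \<and> \<tau> \<union> \<tau>' \<in> level (Suc c)}" by auto
  finally show ?thesis .
qed

end


section \<open>Localization to links\<close>

context weighted_complex
begin

interpretation L: weighted_set "level c" m for c
  by (rule weighted_set_level)

definition nbr :: "'a set \<Rightarrow> 'a set" where
  "nbr \<eta> = {v. v \<notin> \<eta> \<and> insert v \<eta> \<in> X}"

text \<open>Oriented edges: each edge of the link occurs in both directions.\<close>

definition link_edges :: "'a set \<Rightarrow> ('a \<times> 'a) set" where
  "link_edges \<eta> = {(v, u). v \<noteq> u \<and> v \<notin> \<eta> \<and> u \<notin> \<eta> \<and> insert v (insert u \<eta>) \<in> X}"

lemma link_vertex_iff:
  "\<eta> \<in> X \<Longrightarrow> {v} \<in> faces (link X \<eta>) 0 \<longleftrightarrow> v \<in> nbr \<eta>"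
  using face_closed[of "insert v \<eta>" "{v}"] by (auto simp: faces_def link_def nbr_def)

lemma link_edge_iff:
  "\<eta> \<in> X \<Longrightarrow> {v, u} \<in> faces (link X \<eta>) 1 \<longleftrightarrow> (v, u) \<in> link_edges \<eta>"
  using face_closed[of "insert v (insert u \<eta>)" "{v, u}"]
  by (auto simp: faces_def link_def link_edges_def card_insert_if insert_commute)

lemma nbr_bij:
  assumes "\<eta> \<in> level b"
  shows "bij_betw (\<lambda>v. insert v \<eta>) (nbr \<eta>) {\<tau>. \<tau> \<in> level (Suc b) \<and> \<eta> \<subset> \<tau>}"
  unfolding bij_betw_def
proof
  show "inj_on (\<lambda>v. insert v \<eta>) (nbr \<eta>)" by (auto simp: inj_on_def nbr_def)
  have \<eta>: "finite \<eta>" "card \<eta> = b" using assms finite_simplex by (auto simp: level_def)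
  show "(\<lambda>v. insert v \<eta>) ` nbr \<eta> = {\<tau>. \<tau> \<in> level (Suc b) \<and> \<eta> \<subset> \<tau>}"
  proof (intro equalityI subsetI)
    fix \<tau> assume "\<tau> \<in> {\<tau>. \<tau> \<in> level (Suc b) \<and> \<eta> \<subset> \<tau>}"
    then have \<tau>: "\<tau> \<in> X" "card \<tau> = Suc b" "\<eta> \<subseteq> \<tau>" by (auto simp: level_def)
    have "card (\<tau> - \<eta>) = 1" using \<tau> \<eta> by (simp add: card_Diff_subset)
    then obtain v where "\<tau> - \<eta> = {v}" by (rule card_1_singletonE)
    then have "v \<notin> \<eta>" "\<tau> = insert v \<eta>" using \<tau> by auto
    then show "\<tau> \<in> (\<lambda>v. insert v \<eta>) ` nbr \<eta>" using \<tau> by (auto simp: nbr_def)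
  qed (use \<eta> in \<open>auto simp: nbr_def level_def\<close>)
qed

lemma sum_nbr:
  assumes "\<eta> \<in> level b"
  shows "(\<Sum>v\<in>nbr \<eta>. F (insert v \<eta>)) = (\<Sum>\<tau> | \<tau> \<in> level (Suc b) \<and> \<eta> \<subset> \<tau>. F \<tau>)"
  using sum.reindex_bij_betw[OF nbr_bij[OF assms]] by simp

lemma finite_nbr: "\<eta> \<in> X \<Longrightarrow> finite (nbr \<eta>)"
  using bij_betw_finite[OF nbr_bij[of \<eta> "card \<eta>"]]
    finite_subset[OF _ finite_level[of "Suc (card \<eta>)"], of "{\<tau>. \<tau> \<in> level (Suc (card \<eta>)) \<and> \<eta> \<subset> \<tau>}"]
  by (auto simp: level_def)

lemma link_edges_nbr:
  assumes "\<eta> \<in> X" "v \<in> nbr \<eta>"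
  shows "{u. (v, u) \<in> link_edges \<eta>} = nbr (insert v \<eta>)"
  using assms by (auto simp: link_edges_def nbr_def insert_commute)

lemma link_edges_sub: "link_edges \<eta> \<subseteq> nbr \<eta> \<times> nbr \<eta>"
  using face_closed[of "insert v (insert u \<eta>)" "insert v \<eta>" for v u]
    face_closed[of "insert v (insert u \<eta>)" "insert u \<eta>" for v u]
  by (auto simp: link_edges_def nbr_def)

lemma weighted_graph_link:
  assumes \<eta>: "\<eta> \<in> level b" and b: "Suc b \<le> n"
  shows "weighted_graph (link X \<eta>) (link_weight m \<eta>)"
proof
  have \<eta>X: "\<eta> \<in> X" using \<eta> by (simp add: level_def)
  note iff = link_vertex_iff[OF \<eta>X] link_edge_iff[OF \<eta>X]
  show "finite {v. {v} \<in> faces (link X \<eta>) 0}"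
    using finite_nbr[OF \<eta>X] by (simp add: iff)
  show "0 < link_weight m \<eta> {v}" if "{v} \<in> faces (link X \<eta>) 0" for v
    using that weight_pos by (simp add: iff nbr_def link_weight_def)
  show "{v} \<in> faces (link X \<eta>) 0" if "{v, u} \<in> faces (link X \<eta>) 1" for v u
    using that link_edges_sub by (auto simp: iff)
  show "0 \<le> link_weight m \<eta> {v, u}" if "{v, u} \<in> faces (link X \<eta>) 1" for v u
    using that weight_pos[of "insert v (insert u \<eta>)"]
    by (simp add: iff link_edges_def link_weight_def insert_commute less_imp_le)
  show "link_weight m \<eta> {v} = (\<Sum>u | {v, u} \<in> faces (link X \<eta>) 1. link_weight m \<eta> {v, u})"
    if v: "{v} \<in> faces (link X \<eta>) 0" for v
  proof -
    have v': "v \<in> nbr \<eta>" using v by (simp add: iff)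
    then have v\<eta>: "insert v \<eta> \<in> level (Suc b)"
      using \<eta> finite_simplex by (auto simp: level_def nbr_def)
    have "m (insert v \<eta>) = (\<Sum>u\<in>nbr (insert v \<eta>). m (insert v (insert u \<eta>)))"
      using weight_sum[OF v\<eta> b] sum_nbr[OF v\<eta>, of m] by (simp add: insert_commute)
    then show ?thesis
      by (simp add: iff link_edges_nbr[OF \<eta>X v'] link_weight_def)
  qed
qed

text \<open>Adjacent simplices \<open>\<tau> \<noteq> \<tau>'\<close> meet in a common facet \<open>\<eta>\<close>, and each is \<open>\<eta>\<close> with one vertex added; the
  two vertices span an oriented edge in the link of \<open>\<eta>\<close>.\<close>

lemma bij_link_edges_adjacent_pairs:
  "bij_betw (\<lambda>(\<eta>, v, u). (insert v \<eta>, insert u \<eta>)) (SIGMA \<eta>:level b. link_edges \<eta>)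
     (SIGMA \<tau>:level (Suc b). {\<tau>'. \<tau>' \<in> level (Suc b) \<and> \<tau>' \<noteq> \<tau> \<and> \<tau> \<union> \<tau>' \<in> level (Suc (Suc b))})"
  (is "bij_betw ?f ?A ?B")
  unfolding bij_betw_def
proof
  show "inj_on ?f ?A"
  proof (rule inj_onI)
    fix x y assume xy: "x \<in> ?A" "y \<in> ?A" "?f x = ?f y"
    obtain \<eta> v u where x: "x = (\<eta>, v, u)" by (cases x)
    obtain \<eta>' v' u' where y: "y = (\<eta>', v', u')" by (cases y)
    have e: "(v, u) \<in> link_edges \<eta>" "(v', u') \<in> link_edges \<eta>'"
      and eq: "insert v \<eta> = insert v' \<eta>'" "insert u \<eta> = insert u' \<eta>'"
      using xy by (simp_all add: x y)
    have "\<eta> = insert v \<eta> \<inter> insert u \<eta>" "\<eta>' = insert v' \<eta>' \<inter> insert u' \<eta>'"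
      using e by (auto simp: link_edges_def)
    then have "\<eta> = \<eta>'" using eq by simp
    then show "x = y"
      using e eq by (auto simp: link_edges_def x y)
  qed
  show "?f ` ?A = ?B"
  proof
    show "?f ` ?A \<subseteq> ?B"
    proof (rule image_subsetI)
      fix x assume "x \<in> ?A"
      then obtain \<eta> v u where x: "x = (\<eta>, v, u)"
        and \<eta>: "\<eta> \<in> level b" and e: "(v, u) \<in> link_edges \<eta>" by auto
      have "insert v \<eta> \<in> X" "insert u \<eta> \<in> X" using e link_edges_sub by (auto simp: nbr_def)
      moreover have "insert v \<eta> \<union> insert u \<eta> = insert v (insert u \<eta>)" by auto
      ultimately show "?f x \<in> ?B"
        using \<eta> e finite_simplex by (auto simp: x level_def link_edges_def)
    qed
    show "?B \<subseteq> ?f ` ?A"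
    proof
      fix y assume "y \<in> ?B"
      then obtain \<tau> \<tau>' where y: "y = (\<tau>, \<tau>')" and \<tau>: "\<tau> \<in> level (Suc b)" "\<tau>' \<in> level (Suc b)"
        and u: "\<tau> \<union> \<tau>' \<in> level (Suc (Suc b))" by auto
      have fin: "finite \<tau>" "finite \<tau>'" using \<tau> finite_simplex by (auto simp: level_def)
      define \<eta> where "\<eta> = \<tau> \<inter> \<tau>'"
      have "card \<tau> + card \<tau>' = card (\<tau> \<union> \<tau>') + card \<eta>"
        unfolding \<eta>_def using fin by (rule card_Un_Int)
      then have card: "card \<eta> = b" using \<tau> u by (simp add: level_def)
      have "\<eta> \<in> X" using \<tau> face_closed[of \<tau> \<eta>] by (simp add: level_def \<eta>_def)
      then have \<eta>: "\<eta> \<in> level b" using card by (simp add: level_def)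
      have "card (\<tau> - \<eta>) = 1" "card (\<tau>' - \<eta>) = 1"
        using \<tau> fin card by (simp_all add: card_Diff_subset level_def \<eta>_def)
      then obtain v w where vw: "\<tau> - \<eta> = {v}" "\<tau>' - \<eta> = {w}" by (meson card_1_singletonE)
      then have eq: "\<tau> = insert v \<eta>" "\<tau>' = insert w \<eta>" by (auto simp: \<eta>_def)
      moreover have "v \<noteq> w" "v \<notin> \<eta>" "w \<notin> \<eta>" using vw by (auto simp: \<eta>_def)
      moreover have "insert v (insert w \<eta>) = \<tau> \<union> \<tau>'" using eq by auto
      ultimately have "(v, w) \<in> link_edges \<eta>" using u by (auto simp: link_edges_def level_def)
      then show "y \<in> ?f ` ?A" using \<eta> eq by (intro image_eqI[of _ _ "(\<eta>, v, w)"]) (auto simp: y)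
    qed
  qed
qed

definition link_fun :: "('a set \<Rightarrow> real) \<Rightarrow> 'a set \<Rightarrow> 'a \<Rightarrow> real" where
  "link_fun \<phi> \<eta> v = (if v \<in> nbr \<eta> then \<phi> (insert v \<eta>) else 0)"

text \<open>The quadratic form of the walk on the link of \<open>\<eta>\<close> at \<open>link_fun \<phi> \<eta>\<close>.\<close>

definition link_form :: "('a set \<Rightarrow> real) \<Rightarrow> 'a set \<Rightarrow> real" where
  "link_form \<phi> \<eta> = (\<Sum>(v, u)\<in>link_edges \<eta>. m (insert v (insert u \<eta>)) * \<phi> (insert u \<eta>) * \<phi> (insert v \<eta>))"

lemma finite_link_edges: "\<eta> \<in> X \<Longrightarrow> finite (link_edges \<eta>)"
  using finite_subset[OF link_edges_sub] finite_nbr by simp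

lemma up_walk_form_eq_link_forms:
  assumes "Suc b \<le> n"
  shows "ip (Suc b) (cobd_adj (Suc b) (cobd (Suc b) \<phi>)) \<phi> = ip (Suc b) \<phi> \<phi> + (\<Sum>\<eta>\<in>level b. link_form \<phi> \<eta>)"
proof -
  let ?P = "\<lambda>\<tau>. {\<tau>'. \<tau>' \<in> level (Suc b) \<and> \<tau>' \<noteq> \<tau> \<and> \<tau> \<union> \<tau>' \<in> level (Suc (Suc b))}"
  let ?g = "\<lambda>(\<tau>, \<tau>'). m (\<tau> \<union> \<tau>') * \<phi> \<tau>' * \<phi> \<tau>"
  have "ip (Suc b) (cobd_adj (Suc b) (cobd (Suc b) \<phi>)) \<phi>
      = (\<Sum>\<tau>\<in>level (Suc b). m \<tau> * \<phi> \<tau> * \<phi> \<tau> + (\<Sum>\<tau>'\<in>?P \<tau>. ?g (\<tau>, \<tau>')))"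
    unfolding wip_def
  proof (intro sum.cong refl)
    fix \<tau> assume \<tau>: "\<tau> \<in> level (Suc b)"
    show "m \<tau> * cobd_adj (Suc b) (cobd (Suc b) \<phi>) \<tau> * \<phi> \<tau>
        = m \<tau> * \<phi> \<tau> * \<phi> \<tau> + (\<Sum>\<tau>'\<in>?P \<tau>. ?g (\<tau>, \<tau>'))"
      using L.w_pos[OF \<tau>]
      by (simp add: cobd_adj_cobd_eq[OF \<tau> assms] distrib_left distrib_right sum_distrib_left sum_distrib_right)
  qed
  also have "\<dots> = ip (Suc b) \<phi> \<phi> + (\<Sum>\<tau>\<in>level (Suc b). \<Sum>\<tau>'\<in>?P \<tau>. ?g (\<tau>, \<tau>'))"
    by (simp add: sum.distrib wip_def)
  also have "(\<Sum>\<tau>\<in>level (Suc b). \<Sum>\<tau>'\<in>?P \<tau>. ?g (\<tau>, \<tau>')) = sum ?g (Sigma (level (Suc b)) ?P)"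
    using finite_level by (subst sum.Sigma) auto
  also have "\<dots> = (\<Sum>x\<in>(SIGMA \<eta>:level b. link_edges \<eta>). ?g ((\<lambda>(\<eta>, v, u). (insert v \<eta>, insert u \<eta>)) x))"
    by (rule sum.reindex_bij_betw[OF bij_link_edges_adjacent_pairs, symmetric])
  also have "\<dots> = (\<Sum>(\<eta>, v, u)\<in>(SIGMA \<eta>:level b. link_edges \<eta>).
      m (insert v (insert u \<eta>)) * \<phi> (insert u \<eta>) * \<phi> (insert v \<eta>))"
    by (intro sum.cong refl) (auto simp: insert_commute)
  also have "\<dots> = (\<Sum>\<eta>\<in>level b. link_form \<phi> \<eta>)"
    unfolding link_form_def using finite_level finite_link_edges
    by (subst sum.Sigma) (auto simp: level_def)
  finally show ?thesis .
qed

text \<open>On the link of \<open>\<eta>\<close> the total weight is \<open>m \<eta>\<close> and the mean of \<open>\<phi>\<close> is \<open>cobd_adj b \<phi> \<eta>\<close>, so the term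
  compared with \<open>link_form\<close> is the contribution of \<open>\<eta>\<close> to the norm squared of \<open>cobd_adj b \<phi>\<close>.\<close>

lemma link_form_near_mean:
  assumes \<eta>: "\<eta> \<in> level b" and b: "Suc b \<le> n" and lam: "0 \<le> lam"
    and exp: "- lam \<le> smallest_eigenvalue (link X \<eta>) (link_weight m \<eta>)"
      "second_largest_eigenvalue (link X \<eta>) (link_weight m \<eta>) \<le> lam"
  shows "\<bar>link_form \<phi> \<eta> - m \<eta> * cobd_adj b \<phi> \<eta> * cobd_adj b \<phi> \<eta>\<bar>
    \<le> lam * (\<Sum>\<tau> | \<tau> \<in> level (Suc b) \<and> \<eta> \<subset> \<tau>. m \<tau> * \<phi> \<tau> * \<phi> \<tau>)"
proof -
  interpret G: weighted_graph "link X \<eta>" "link_weight m \<eta>"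
    using \<eta> b by (rule weighted_graph_link)
  have \<eta>X: "\<eta> \<in> X" using \<eta> by (simp add: level_def)
  have V: "G.V = nbr \<eta>" by (simp add: G.V_def link_vertex_iff[OF \<eta>X])
  have deg: "G.deg v = m (insert v \<eta>)" for v by (subst G.deg_def) (simp add: link_weight_def)
  have ew: "G.ew v u = (if (v, u) \<in> link_edges \<eta> then m (insert v (insert u \<eta>)) else 0)" for v u
    by (subst G.ew_def) (simp add: link_edge_iff[OF \<eta>X] link_weight_def)
  let ?g = "link_fun \<phi> \<eta>"
  have form: "wip G.V G.deg (G.walk ?g) ?g = link_form \<phi> \<eta>"
  proof -
    let ?h = "\<lambda>(v, u). m (insert v (insert u \<eta>)) * \<phi> (insert u \<eta>) * \<phi> (insert v \<eta>)"
    have "wip G.V G.deg (G.walk ?g) ?g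
        = (\<Sum>v\<in>nbr \<eta>. \<Sum>u\<in>nbr \<eta>. if (v, u) \<in> link_edges \<eta> then ?h (v, u) else 0)"
      unfolding G.wip_walk unfolding V by (intro sum.cong refl) (simp add: ew link_fun_def)
    also have "\<dots> = (\<Sum>p\<in>nbr \<eta> \<times> nbr \<eta>. if p \<in> link_edges \<eta> then ?h p else 0)"
      unfolding sum.cartesian_product by (intro sum.cong refl) auto
    also have "\<dots> = sum ?h {p \<in> nbr \<eta> \<times> nbr \<eta>. p \<in> link_edges \<eta>}"
      using finite_nbr[OF \<eta>X] by (intro sum.inter_filter[symmetric]) simp
    also have "{p \<in> nbr \<eta> \<times> nbr \<eta>. p \<in> link_edges \<eta>} = link_edges \<eta>"
      using link_edges_sub by blast
    finally show ?thesis by (simp add: link_form_def)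
  qed
  have total: "(\<Sum>v\<in>G.V. G.deg v) = m \<eta>"
    using sum_nbr[OF \<eta>, of m] weight_sum[OF \<eta>] b by (simp add: V deg)
  have mean: "wip G.V G.deg ?g (indicat_real G.V) = m \<eta> * cobd_adj b \<phi> \<eta>"
  proof -
    have "wip G.V G.deg ?g (indicat_real G.V) = (\<Sum>v\<in>nbr \<eta>. m (insert v \<eta>) * \<phi> (insert v \<eta>))"
      by (simp add: wip_def V deg link_fun_def)
    also have "\<dots> = m \<eta> * cobd_adj b \<phi> \<eta>"
      using sum_nbr[OF \<eta>, of "\<lambda>\<tau>. m \<tau> * \<phi> \<tau>"] \<eta> L.w_pos[OF \<eta>]
      by (simp add: cobd_adj_def sum_distrib_left)
    finally show ?thesis .
  qed
  have norm: "wip G.V G.deg ?g ?g = (\<Sum>\<tau> | \<tau> \<in> level (Suc b) \<and> \<eta> \<subset> \<tau>. m \<tau> * \<phi> \<tau> * \<phi> \<tau>)"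
    using sum_nbr[OF \<eta>, of "\<lambda>\<tau>. m \<tau> * \<phi> \<tau> * \<phi> \<tau>"] by (simp add: wip_def V deg link_fun_def)
  have "?g \<in> supported G.V" by (simp add: supported_def link_fun_def V)
  from G.expander_walk_near_mean[OF exp lam this] show ?thesis
    using L.w_pos[OF \<eta>] by (simp add: form total mean norm power2_eq_square mult_ac)
qed

end

locale local_expander = weighted_complex +
  fixes lam :: real
  assumes dim_pos: "1 \<le> n" and expander: "two_sided_local_spectral_expander X n m lam"
begin

interpretation L: weighted_set "level c" m for c
  by (rule weighted_set_level)

lemma link_eigenvalue_bounds:
  assumes "\<eta> \<in> level b" "Suc b \<le> n"
  shows "- lam \<le> smallest_eigenvalue (link X \<eta>) (link_weight m \<eta>)"
    "second_largest_eigenvalue (link X \<eta>) (link_weight m \<eta>) \<le> lam"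
proof -
  have "\<eta> \<in> faces X (int b - 1)" "-1 \<le> int b - 1 \<and> int b - 1 \<le> int n - 2"
    using assms by (auto simp: faces_level)
  then show "- lam \<le> smallest_eigenvalue (link X \<eta>) (link_weight m \<eta>)"
    "second_largest_eigenvalue (link X \<eta>) (link_weight m \<eta>) \<le> lam"
    using expander unfolding two_sided_local_spectral_expander_def by blast+
qed

text \<open>The link of the empty simplex is the complex itself, which has two vertices since its dimension
  is at least \<open>1\<close>.\<close>

lemma lam_nonneg: "0 \<le> lam"
proof -
  have e: "{} \<in> level 0" using empty_in_X by (simp add: level_def)
  interpret G: weighted_graph "link X {}" "link_weight m {}"
    using weighted_graph_link[OF e] dim_pos by simp
  obtain \<sigma> where \<sigma>: "\<sigma> \<in> X" "card \<sigma> = Suc n"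
    using facet_exists[OF empty_in_X] by metis
  then obtain u v where uv: "u \<in> \<sigma>" "v \<in> \<sigma>" "u \<noteq> v"
    using dim_pos by (metis One_nat_def card_le_Suc0_iff_eq finite_simplex not_less_eq_eq)
  then have "u \<in> G.V" "v \<in> G.V"
    using face_closed[OF \<sigma>(1)] empty_in_X by (auto simp: G.V_def link_vertex_iff nbr_def)
  with uv(3) show ?thesis
    using G.expander_parameter_nonneg link_eigenvalue_bounds[OF e] dim_pos by simp
qed

text \<open>By self-adjointness it is enough to bound the quadratic form, which is the sum over \<open>\<eta>\<close> of the
  differences bounded in \<open>link_form_near_mean\<close>. Each simplex with \<open>b + 1\<close> vertices is counted once for
  each of its \<open>b + 1\<close> facets.\<close>

lemma up_down_walk_difference:
  assumes b: "Suc b \<le> n" and \<phi>: "\<phi> \<in> supported (level (Suc b))"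
  shows "nm (Suc b) (cobd_adj (Suc b) (cobd (Suc b) \<phi>) - \<phi> - cobd b (cobd_adj b \<phi>))
    \<le> real (Suc b) * lam * nm (Suc b) \<phi>"
proof -
  let ?T = "\<lambda>\<phi>. cobd_adj (Suc b) (cobd (Suc b) \<phi>) - \<phi> - cobd b (cobd_adj b \<phi>)"
  show ?thesis
  proof (rule L.selfadjoint_norm_bound[where T = ?T and W = "supported (level (Suc b))"])
    show "?T f \<in> supported (level (Suc b))" if "f \<in> supported (level (Suc b))" for f
      using that by (intro fs.subspace_diff[OF subspace_supported] cobd_adj_supported cobd_supported)
    show "?T (f + g) = ?T f + ?T g" for f g
      by (simp add: cobd_linear cobd_adj_linear algebra_simps)
    show "?T (fun_scale a f) = fun_scale a (?T f)" for a f
      by (simp add: cobd_linear cobd_adj_linear fs.scale_right_diff_distrib)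
    show "ip (Suc b) (?T f) g = ip (Suc b) f (?T g)" for f g
      using cobd_adjoint[of "Suc b" f "cobd (Suc b) g"] cobd_adjoint[of "Suc b" g "cobd (Suc b) f"]
        cobd_adjoint[of b "cobd_adj b f" g] cobd_adjoint[of b "cobd_adj b g" f]
      by (simp add: wip_linear wip_commute)
    show "\<bar>ip (Suc b) (?T f) f\<bar> \<le> real (Suc b) * lam * ip (Suc b) f f" for f
    proof -
      have "ip (Suc b) (?T f) f = (\<Sum>\<eta>\<in>level b. link_form f \<eta> - m \<eta> * cobd_adj b f \<eta> * cobd_adj b f \<eta>)"
        by (simp add: wip_linear up_walk_form_eq_link_forms[OF b] cobd_adjoint sum_subtractf)
          (simp add: wip_def)
      also have "\<bar>\<dots>\<bar> \<le> (\<Sum>\<eta>\<in>level b. \<bar>link_form f \<eta> - m \<eta> * cobd_adj b f \<eta> * cobd_adj b f \<eta>\<bar>)"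
        by (rule sum_abs)
      also have "\<dots> \<le> (\<Sum>\<eta>\<in>level b. lam * (\<Sum>\<tau> | \<tau> \<in> level (Suc b) \<and> \<eta> \<subset> \<tau>. m \<tau> * f \<tau> * f \<tau>))"
        using b lam_nonneg link_eigenvalue_bounds by (intro sum_mono link_form_near_mean) auto
      also have "\<dots> = lam * (real (Suc b) * ip (Suc b) f f)"
        by (simp only: sum_distrib_left[symmetric] sum_over_facets wip_def)
      finally show ?thesis by (simp add: mult_ac)
    qed
  qed (use \<phi> subspace_supported in auto)
qed

end


section \<open>The filtration and its orthogonal complements\<close>

context weighted_complex
begin

interpretation L: weighted_set "level c" m for c
  by (rule weighted_set_level)

lemma cinner_eq: "cinner X m k = ip (Suc k)"
  by (simp add: cinner_def wip_def faces_level fun_eq_iff)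

lemma cnorm_eq: "cnorm X m k = nm (Suc k)"
  by (simp add: cnorm_def wnorm_def cinner_eq fun_eq_iff)

lemma cochains_eq: "cochains X k = supported (level (Suc k))"
  by (simp add: cochains_def supported_def faces_level)

lemma sdiff_eq: "sdiff X k = cobd (Suc k)"
  by (simp add: sdiff_def cobd_def faces_level fun_eq_iff)

lemma sdiff_adj_eq: "sdiff_adj X m k \<psi> = cobd_adj (Suc k) \<psi>"
  unfolding sdiff_adj_def
proof (rule the_equality)
  show "cobd_adj (Suc k) \<psi> \<in> cochains X k \<and>
    (\<forall>\<phi>\<in>cochains X k. cinner X m (k + 1) (sdiff X k \<phi>) \<psi> = cinner X m k \<phi> (cobd_adj (Suc k) \<psi>))"
    by (simp add: cochains_eq cinner_eq sdiff_eq cobd_adj_supported cobd_adjoint)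
  fix \<xi> assume \<xi>: "\<xi> \<in> cochains X k \<and>
    (\<forall>\<phi>\<in>cochains X k. cinner X m (k + 1) (sdiff X k \<phi>) \<psi> = cinner X m k \<phi> \<xi>)"
  define d where "d = \<xi> - cobd_adj (Suc k) \<psi>"
  have d: "d \<in> supported (level (Suc k))"
    unfolding d_def using \<xi> by (intro fs.subspace_diff[OF subspace_supported] cobd_adj_supported) (simp add: cochains_eq)
  have "ip (Suc k) d \<xi> = ip (Suc k) d (cobd_adj (Suc k) \<psi>)"
    using \<xi> d by (simp add: cochains_eq cinner_eq sdiff_eq cobd_adjoint)
  then have "ip (Suc k) d d = 0"
    by (subst (2) d_def) (simp add: wip_linear)
  then show "\<xi> = cobd_adj (Suc k) \<psi>" using L.wip_self_eq_0_iff[OF d] by (simp add: d_def)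
qed

lemma upper_walk_eq:
  assumes "Suc k \<le> n"
  shows "upper_walk X m k \<phi> = fun_scale (1 / (real k + 2)) (cobd_adj (Suc k) (cobd (Suc k) \<phi>))"
proof
  fix \<tau>
  show "upper_walk X m k \<phi> \<tau> = fun_scale (1 / (real k + 2)) (cobd_adj (Suc k) (cobd (Suc k) \<phi>)) \<tau>"
  proof (cases "\<tau> \<in> level (Suc k)")
    case True
    let ?P = "\<lambda>\<tau>'. \<tau> \<union> \<tau>' \<in> level (Suc (Suc k))"
    have "upper_walk X m k \<phi> \<tau> = (\<Sum>\<tau>'\<in>level (Suc k). upper_walk_entry X m k \<tau> \<tau>' * \<phi> \<tau>')"
      using True by (simp add: upper_walk_def faces_level)
    also have "\<dots> = upper_walk_entry X m k \<tau> \<tau> * \<phi> \<tau>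
        + (\<Sum>\<tau>'\<in>level (Suc k) - {\<tau>}. upper_walk_entry X m k \<tau> \<tau>' * \<phi> \<tau>')"
      using True finite_level by (simp add: sum.remove)
    also have "upper_walk_entry X m k \<tau> \<tau> = 1 / (real k + 2)" by (simp add: upper_walk_entry_def)
    also have "(\<Sum>\<tau>'\<in>level (Suc k) - {\<tau>}. upper_walk_entry X m k \<tau> \<tau>' * \<phi> \<tau>')
        = (\<Sum>\<tau>'\<in>level (Suc k) - {\<tau>}. if ?P \<tau>' then 1 / (real k + 2) * (m (\<tau> \<union> \<tau>') / m \<tau> * \<phi> \<tau>') else 0)"
      by (intro sum.cong refl) (auto simp: upper_walk_entry_def faces_level)
    also have "\<dots> = (\<Sum>\<tau>'\<in>{\<tau>' \<in> level (Suc k) - {\<tau>}. ?P \<tau>'}. 1 / (real k + 2) * (m (\<tau> \<union> \<tau>') / m \<tau> * \<phi> \<tau>'))"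
      by (rule sum.inter_filter[symmetric]) (simp add: finite_level)
    also have "{\<tau>' \<in> level (Suc k) - {\<tau>}. ?P \<tau>'} = {\<tau>'. \<tau>' \<in> level (Suc k) \<and> \<tau>' \<noteq> \<tau> \<and> ?P \<tau>'}" by auto
    finally show ?thesis
      using True by (simp only: cobd_adj_cobd_eq[OF True assms] fun_scale_apply distrib_left sum_distrib_left)
  qed (simp add: upper_walk_def faces_level cobd_adj_def)
qed

lemma cochains0_eq: "cochains0 X m k = {\<phi> \<in> supported (level (Suc k)). ip (Suc k) \<phi> 1 = 0}"
  by (simp add: cochains0_def cochains_eq wip_def faces_level)

lemma subspace_cochains0: "fs.subspace (cochains0 X m k)"
  using fs.subspace_add[OF subspace_supported] fs.subspace_scale[OF subspace_supported]
  by (auto simp: fs.subspace_def cochains0_eq supported_def wip_linear)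

text \<open>The adjoint averages, so it fixes the constant \<open>1\<close>; together with the next lemma this shows that the
  differential and its adjoint preserve the cochains of integral \<open>0\<close>.\<close>

lemma ip_cobd_one:
  assumes "c \<le> n" shows "ip (Suc c) (cobd c \<phi>) 1 = ip c \<phi> 1"
proof -
  have "cobd_adj c 1 \<tau> = 1" if "\<tau> \<in> level c" for \<tau>
    using L.w_pos[OF that] weight_sum[OF that assms] that by (simp add: cobd_adj_def flip: sum_divide_distrib)
  then show ?thesis unfolding cobd_adjoint by (intro wip_cong) auto
qed

lemma ip_cobd_adj_one: "ip c (cobd_adj c \<psi>) 1 = real (Suc c) * ip (Suc c) \<psi> 1"
proof -
  have "ip c (cobd_adj c \<psi>) 1 = ip (Suc c) (cobd c 1) \<psi>"
    by (metis cobd_adjoint wip_commute)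
  also have "\<dots> = ip (Suc c) (fun_scale (real (Suc c)) 1) \<psi>"
    by (intro wip_cong) (simp_all add: cobd_def card_facets)
  finally show ?thesis by (simp only: wip_linear wip_commute[of _ m 1])
qed

text \<open>\<open>Fil k j\<close> is \<open>Vspace X m k j\<close> for \<open>j < k\<close>, but for \<open>j = k\<close> it is all of \<open>cochains0 X m k\<close>, whereas
  \<open>Vspace X m k k\<close> is, for \<open>k > 0\<close>, the complement of the previous step. With this choice the steps increase with
  \<open>j\<close> and the \<open>U\<close> are defined uniformly.\<close>

definition Fil :: "nat \<Rightarrow> nat \<Rightarrow> ('a set \<Rightarrow> real) set" where
  "Fil k j = sdiff_iter X j (k - j) ` cochains0 X m j"

lemma Fil_top: "Fil k k = cochains0 X m k"
  by (simp add: Fil_def)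

lemma Fil_Suc: "j \<le> k \<Longrightarrow> Fil (Suc k) j = cobd (Suc k) ` Fil k j"
  by (simp add: Fil_def Suc_diff_le sdiff_eq image_image)

lemma cobd_cochains0:
  assumes "Suc k \<le> n" "\<phi> \<in> cochains0 X m k" shows "cobd (Suc k) \<phi> \<in> cochains0 X m (Suc k)"
  using assms by (simp add: cochains0_eq cobd_supported ip_cobd_one)

lemma subspace_image_cobd:
  assumes "fs.subspace W" shows "fs.subspace (cobd c ` W)"
  unfolding fs.subspace_def
proof (intro conjI ballI allI)
  show "0 \<in> cobd c ` W" using fs.subspace_0[OF assms] cobd_zero by (metis imageI)
  show "x + y \<in> cobd c ` W" if "x \<in> cobd c ` W" "y \<in> cobd c ` W" for x y
    using that fs.subspace_add[OF assms] by (auto simp flip: cobd_linear(1))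
  show "fun_scale a x \<in> cobd c ` W" if "x \<in> cobd c ` W" for a x
    using that fs.subspace_scale[OF assms] by (auto simp flip: cobd_linear(3))
qed

lemma subspace_Fil: "j \<le> k \<Longrightarrow> fs.subspace (Fil k j)"
proof (induction k)
  case (Suc k)
  then show ?case
    by (cases "j = Suc k") (auto simp: Fil_top subspace_cochains0 Fil_Suc
        simp del: fun_scale_apply intro!: subspace_image_cobd)
qed (simp add: Fil_top subspace_cochains0)

lemma Fil_sub: "j \<le> k \<Longrightarrow> k \<le> n \<Longrightarrow> Fil k j \<subseteq> cochains0 X m k"
proof (induction k)
  case (Suc k)
  then show ?case
    by (cases "j = Suc k") (auto simp: Fil_top Fil_Suc intro!: cobd_cochains0)
qed (simp add: Fil_top)

lemma Fil_supported: "j \<le> k \<Longrightarrow> k \<le> n \<Longrightarrow> Fil k j \<subseteq> supported (level (Suc k))"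
  using Fil_sub by (auto simp: cochains0_eq)

lemma Fil_mono: "i \<le> j \<Longrightarrow> j \<le> k \<Longrightarrow> k \<le> n \<Longrightarrow> Fil k i \<subseteq> Fil k j"
proof (induction k)
  case (Suc k)
  show ?case
  proof (cases "j = Suc k")
    case True
    then show ?thesis using Fil_sub[of i "Suc k"] Suc.prems by (simp add: Fil_top)
  next
    case False
    then show ?thesis using Suc by (auto simp: Fil_Suc)
  qed
qed simp

definition Ucomp :: "nat \<Rightarrow> nat \<Rightarrow> ('a set \<Rightarrow> real) set" where
  "Ucomp k j = {\<psi> \<in> Fil k j. \<forall>i<j. \<forall>\<eta>\<in>Fil k i. ip (Suc k) \<psi> \<eta> = 0}"

text \<open>The steps increase, so orthogonality to the previous one is enough.\<close>

lemma Ucomp_pred: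
  assumes "0 < j" "j \<le> k" "k \<le> n"
  shows "Ucomp k j = {\<psi> \<in> Fil k j. \<forall>\<eta>\<in>Fil k (j - 1). ip (Suc k) \<psi> \<eta> = 0}"
proof -
  have "Fil k i \<subseteq> Fil k (j - 1)" if "i < j" for i
    using that assms by (intro Fil_mono) auto
  moreover have "j - 1 < j" using assms by simp
  ultimately show ?thesis unfolding Ucomp_def by blast
qed

text \<open>The kernel of an adjoint is the orthogonal complement of the image. Only cochains of integral \<open>0\<close> enter in \<open>Fil\<close>; they suffice as the adjoint of a cochain
  of integral \<open>0\<close> has integral \<open>0\<close> itself.\<close>

lemma coclosed_iff:
  assumes "Suc k \<le> n" "\<psi> \<in> cochains0 X m (Suc k)"
  shows "cobd_adj (Suc k) \<psi> = 0 \<longleftrightarrow> (\<forall>\<eta>\<in>Fil (Suc k) k. ip (Suc (Suc k)) \<psi> \<eta> = 0)"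
proof -
  have Fil: "Fil (Suc k) k = cobd (Suc k) ` cochains0 X m k" by (simp add: Fil_Suc Fil_top)
  have ip: "ip (Suc (Suc k)) \<psi> (cobd (Suc k) \<theta>) = ip (Suc k) \<theta> (cobd_adj (Suc k) \<psi>)" for \<theta>
    using cobd_adjoint[of "Suc k" \<theta> \<psi>] by (simp add: wip_commute)
  have u: "cobd_adj (Suc k) \<psi> \<in> cochains0 X m k"
    using assms(2) by (simp add: cochains0_eq cobd_adj_supported ip_cobd_adj_one)
  show ?thesis
  proof
    assume "\<forall>\<eta>\<in>Fil (Suc k) k. ip (Suc (Suc k)) \<psi> \<eta> = 0"
    then have "ip (Suc k) (cobd_adj (Suc k) \<psi>) (cobd_adj (Suc k) \<psi>) = 0" using u by (simp add: Fil ip)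
    then show "cobd_adj (Suc k) \<psi> = 0" using L.wip_self_eq_0_iff[OF cobd_adj_supported] by blast
  qed (simp add: Fil ip)
qed

lemma Uspace_eq:
  assumes "j \<le> k" "k \<le> n"
  shows "Uspace X m k j = Ucomp k j"
proof -
  have V: "Vspace X m k i = Fil k i" if "i < k" for i using that by (simp add: Vspace_def Fil_def)
  consider "k = 0" | "0 < k" "j = 0" | "0 < j" "j < k" | k' where "k = Suc k'" "j = k"
    using assms(1) by (cases k) (auto simp: le_less)
  then show ?thesis
  proof cases
    case 1
    then show ?thesis using assms by (simp add: Uspace_def Vspace_def Ucomp_def Fil_top)
  next
    case 2
    then show ?thesis by (simp add: Uspace_def V Ucomp_def)
  next
    case 3
    then have "Uspace X m k j = {\<psi> \<in> Fil k j. \<forall>\<eta>\<in>Fil k (j - 1). ip (Suc k) \<psi> \<eta> = 0}"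
      using Fil_supported[of j k] assms
      by (auto simp: Uspace_def V orth_compl_def cinner_eq cochains_eq)
    then show ?thesis using 3 assms by (simp add: Ucomp_pred)
  next
    case 4
    have "Uspace X m k j = {\<psi> \<in> supported (level (Suc k)). cobd_adj (Suc k') \<psi> = 0}"
      using 4 by (simp add: Uspace_def Vspace_def cochains_eq sdiff_adj_eq)
    moreover have "\<psi> \<in> cochains0 X m k" if "\<psi> \<in> supported (level (Suc k))" "cobd_adj (Suc k') \<psi> = 0" for \<psi>
      using that ip_cobd_adj_one[of "Suc k'" \<psi>] 4 by (simp add: cochains0_eq)
    moreover have "cochains0 X m k \<subseteq> supported (level (Suc k))" by (auto simp: cochains0_eq)
    ultimately have "Uspace X m k j = {\<psi> \<in> cochains0 X m k. cobd_adj (Suc k') \<psi> = 0}" by blast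
    then show ?thesis using 4 assms coclosed_iff[of k'] by (auto simp: Ucomp_pred Fil_top)
  qed
qed

lemma subspace_Ucomp: "j \<le> k \<Longrightarrow> fs.subspace (Ucomp k j)"
  using subspace_Fil[of j k] by (auto simp: fs.subspace_def Ucomp_def wip_linear)

text \<open>Peel off the projection to the previous step of the filtration.\<close>

lemma Ucomp_decomposition:
  assumes "j \<le> k" "k \<le> n" "\<theta> \<in> Fil k j"
  obtains t where "\<And>i. i \<le> j \<Longrightarrow> t i \<in> Ucomp k i" "\<theta> = (\<Sum>i\<le>j. t i)"
proof -
  have "\<exists>t. (\<forall>i\<le>j. t i \<in> Ucomp k i) \<and> \<theta> = (\<Sum>i\<le>j. t i)"
    using assms
  proof (induction j arbitrary: \<theta>)
    case 0
    have "\<theta> \<in> Ucomp k 0" using 0 by (simp add: Ucomp_def)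
    then show ?case by (intro exI[of _ "\<lambda>_. \<theta>"]) simp
  next
    case (Suc j)
    have jk: "j \<le> k" using Suc.prems by simp
    obtain p where p: "p \<in> Fil k j" "\<And>g. g \<in> Fil k j \<Longrightarrow> ip (Suc k) (\<theta> - p) g = 0"
      using L.projection_exists[OF subspace_Fil Fil_supported] jk Suc.prems(2) by metis
    obtain t where t: "\<forall>i\<le>j. t i \<in> Ucomp k i" "p = (\<Sum>i\<le>j. t i)"
      using Suc.IH[OF jk Suc.prems(2) p(1)] by blast
    have "p \<in> Fil k (Suc j)" using p(1) Fil_mono[of j "Suc j" k] Suc.prems by auto
    then have "\<theta> - p \<in> Fil k (Suc j)"
      using Suc.prems by (intro fs.subspace_diff[OF subspace_Fil])
    then have U: "\<theta> - p \<in> Ucomp k (Suc j)" using p(2) Suc.prems by (simp add: Ucomp_pred)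
    have "\<theta> = (\<Sum>i\<le>Suc j. (t(Suc j := \<theta> - p)) i)" by (simp add: t(2))
    moreover have "\<forall>i\<le>Suc j. (t(Suc j := \<theta> - p)) i \<in> Ucomp k i" using t(1) U by (simp add: le_Suc_eq)
    ultimately show ?case by blast
  qed
  then show ?thesis using that by blast
qed

lemma Ucomp_orthogonal:
  assumes "f \<in> Ucomp k i" "g \<in> Ucomp k l" "i \<noteq> l"
  shows "ip (Suc k) f g = 0"
  using assms by (cases i l rule: linorder_cases) (auto simp: Ucomp_def wip_commute[of _ m f])

end

section \<open>Induction on the dimension\<close>

text \<open>Here \<open>a = |\<theta>|\<close> and \<open>b = |d \<theta>|\<close>. Smallness of \<open>\<epsilon>\<close> gives \<open>\<epsilon> sqrt K \<le> 1/4\<close>, so \<open>a \<le> 2 b\<close>; the other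
  factors fit since \<open>sqrt (K + 1) sqrt K \<le> K + 1 \<le> 1 + 2 K sqrt K\<close>.\<close>

lemma error_constant_step:
  fixes K \<epsilon> a b :: real
  assumes K: "1 \<le> K" and \<epsilon>: "0 \<le> \<epsilon>" "\<epsilon> \<le> 1 / (2 * (1 + 2 * K * sqrt K))"
    and ab: "0 \<le> a" "0 \<le> b" and gap: "(1 - \<epsilon> * sqrt K) * a\<^sup>2 \<le> b\<^sup>2"
  shows "sqrt (K + 1) * (K * sqrt K * \<epsilon> * a) \<le> 2 * K * (1 + 2 * K * sqrt K) * \<epsilon> * b"
proof -
  have s: "1 \<le> sqrt K" using K by simp
  have Ks: "sqrt K \<le> K * sqrt K" "K \<le> K * sqrt K" using K s by simp_all
  have "\<epsilon> * (2 * (1 + 2 * K * sqrt K)) \<le> 1"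
    using \<epsilon>(2) K by (simp add: pos_le_divide_eq add_pos_nonneg)
  moreover have "\<epsilon> * (4 * sqrt K) \<le> \<epsilon> * (2 * (1 + 2 * K * sqrt K))"
    using Ks(1) \<epsilon>(1) by (intro mult_left_mono) auto
  ultimately have "\<epsilon> * sqrt K \<le> 1 / 4" by simp
  then have "1 / 4 * a\<^sup>2 \<le> (1 - \<epsilon> * sqrt K) * a\<^sup>2" by (intro mult_right_mono) auto
  then have "a\<^sup>2 \<le> (2 * b)\<^sup>2" using gap by (simp add: power_mult_distrib)
  then have a: "a \<le> 2 * b" by (rule power2_le_imp_le) (use ab in simp)
  have "sqrt (K + 1) * sqrt K \<le> sqrt (K + 1) * sqrt (K + 1)"
    using K by (intro mult_left_mono) auto
  also have "\<dots> = K + 1" using K by simp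
  also have "\<dots> \<le> 1 + 2 * K * sqrt K"
    unfolding mult.assoc using Ks(2) K by linarith
  finally have c: "sqrt (K + 1) * sqrt K \<le> 1 + 2 * K * sqrt K" .
  have "sqrt (K + 1) * (K * sqrt K * \<epsilon> * a) = (sqrt (K + 1) * sqrt K) * (K * \<epsilon> * a)" by simp
  also have "\<dots> \<le> (1 + 2 * K * sqrt K) * (K * \<epsilon> * (2 * b))"
    using a ab c K \<epsilon>(1) by (intro mult_mono) auto
  finally show ?thesis by (simp add: mult_ac)
qed

context local_expander
begin

interpretation L: weighted_set "level c" m for c
  by (rule weighted_set_level)

lemma eps_nonneg: "0 \<le> eps lam k"
  using lam_nonneg by (induction k) auto

text \<open>The recursion for \<open>eps\<close> mirrors the induction step: \<open>(k + 1) lam\<close> is the cost of replacing \<open>d\<^sup>* d\<close> by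
  \<open>I + d d\<^sup>*\<close>, and the multiple of the previous constant bounds the error of \<open>d d\<^sup>*\<close> inherited from one
  dimension below.\<close>

lemma up_walk_near_scalar_on_Ucomp:
  assumes small: "\<forall>k. k + 2 \<le> n \<longrightarrow>
           eps lam k \<le> 1 / (2 * (1 + 2 * (real k + 1) * sqrt (real k + 1)))"
    and "Suc k \<le> n" "j \<le> k" "\<psi> \<in> Ucomp k j"
  shows "nm (Suc k) (cobd_adj (Suc k) (cobd (Suc k) \<psi>) - fun_scale (real k + 1 - real j) \<psi>)
    \<le> eps lam k * nm (Suc k) \<psi>"
  using assms(2-)
proof (induction k arbitrary: j \<psi>)
  case 0
  then have \<psi>: "\<psi> \<in> supported (level (Suc 0))" "ip (Suc 0) \<psi> 1 = 0"
    by (auto simp: Ucomp_def Fil_top cochains0_eq)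
  \<comment> \<open>The average of \<open>\<psi>\<close> over the only \<open>-1\<close>-simplex vanishes.\<close>
  have "ip 0 (cobd_adj 0 \<psi>) 1 = 0" using ip_cobd_adj_one[of 0 \<psi>] \<psi>(2) by simp
  moreover have "level 0 = {{}}" using empty_in_X finite_simplex by (auto simp: level_def)
  ultimately have "cobd_adj 0 \<psi> {} = 0" using weight_pos[OF empty_in_X] by (simp add: wip_def)
  then have "cobd_adj 0 \<psi> = 0" using \<open>level 0 = {{}}\<close> by (auto simp: cobd_adj_def fun_eq_iff)
  then show ?case
    using up_down_walk_difference[OF 0(1) \<psi>(1)] 0(2) by (simp add: cobd_zero del: minus_apply)
next
  case (Suc k)
  let ?K = "Suc k"
  let ?\<epsilon> = "eps lam k"
  have kn: "Suc k \<le> n" and kn': "k \<le> n" using Suc.prems by auto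
  have \<psi>F: "\<psi> \<in> Fil ?K j" using Suc.prems(3) by (simp add: Ucomp_def)
  then have \<psi>0: "\<psi> \<in> cochains0 X m ?K" using Fil_sub[OF Suc.prems(2) kn] by blast
  then have \<psi>s: "\<psi> \<in> supported (level (Suc ?K))" by (simp add: cochains0_eq)
  note T = up_down_walk_difference[OF Suc.prems(1) \<psi>s]
  have main: "nm (Suc ?K) (cobd ?K (cobd_adj ?K \<psi>) - fun_scale (real ?K - real j) \<psi>)
      \<le> 2 * real ?K * (1 + 2 * real ?K * sqrt (real ?K)) * ?\<epsilon> * nm (Suc ?K) \<psi>"
  proof (cases "j = ?K")
    case True
    have "cobd_adj ?K \<psi> = 0"
      using coclosed_iff[OF kn \<psi>0] Suc.prems(3) by (auto simp: True Ucomp_def)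
    then have "nm (Suc ?K) (cobd ?K (cobd_adj ?K \<psi>) - fun_scale (real ?K - real j) \<psi>) = 0"
      by (simp add: True cobd_zero wnorm_def)
    moreover have "0 \<le> 2 * real ?K * (1 + 2 * real ?K * sqrt (real ?K)) * ?\<epsilon> * nm (Suc ?K) \<psi>"
      by (intro mult_nonneg_nonneg add_nonneg_nonneg eps_nonneg L.wnorm_nonneg) auto
    ultimately show ?thesis by simp
  next
    case False
    then have j: "j \<le> k" using Suc.prems(2) by simp
    obtain \<theta> where \<theta>: "\<theta> \<in> Fil k j" "\<psi> = cobd ?K \<theta>" using \<psi>F j by (auto simp: Fil_Suc)
    obtain t where t: "\<And>i. i \<le> j \<Longrightarrow> t i \<in> Ucomp k i" "\<theta> = (\<Sum>i\<le>j. t i)"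
      using Ucomp_decomposition[OF j kn' \<theta>(1)] by blast
    define \<beta> where "\<beta> = cobd_adj ?K \<psi>"
    have \<beta>: "\<beta> = (\<Sum>i\<le>j. cobd_adj ?K (cobd ?K (t i)))"
      by (simp only: \<beta>_def \<theta>(2) t(2) cobd_sum cobd_adj_sum)
    have \<beta>_dot: "ip ?K \<beta> f = ip (Suc ?K) \<psi> (cobd ?K f)" for f
      using cobd_adjoint[of ?K f \<psi>] by (simp add: \<beta>_def wip_commute)
    have near: "nm ?K (cobd_adj ?K (cobd ?K (t i)) - fun_scale (real ?K - real i) (t i)) \<le> ?\<epsilon> * nm ?K (t i)"
      if "i \<le> j" for i
      using Suc.IH[OF kn _ t(1)[OF that]] that j
      by (simp add: add.commute del: minus_apply fun_scale_apply)
    have low: "ip ?K \<beta> (t i) = 0" if "i < j" for i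
    proof -
      have "t i \<in> Fil k i" using t(1)[of i] that by (simp add: Ucomp_def)
      then have "cobd ?K (t i) \<in> Fil ?K i" using that j by (simp add: Fil_Suc)
      then show ?thesis using Suc.prems(3) that by (simp add: \<beta>_dot Ucomp_def)
    qed
    have orth: "ip ?K (t i) (t l) = 0" if "i \<le> j" "l \<le> j" "i \<noteq> l" for i l
      using Ucomp_orthogonal t(1) that by blast
    have jK: "j < ?K" using j by simp
    \<comment> \<open>\<open>cobd\<close> intertwines \<open>cobd_adj cobd\<close> on \<open>\<theta>\<close> with \<open>cobd cobd_adj\<close> on \<open>\<psi>\<close>, at the cost of its norm.\<close>
    note step = L.near_eigenvector_step[OF jK eps_nonneg orth near t(2) \<beta> low]
    have "cobd ?K (cobd_adj ?K \<psi>) - fun_scale (real ?K - real j) \<psi>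
        = cobd ?K (\<beta> - fun_scale (real ?K - real j) \<theta>)"
      by (simp add: \<beta>_def cobd_linear \<theta>(2))
    then have "nm (Suc ?K) (cobd ?K (cobd_adj ?K \<psi>) - fun_scale (real ?K - real j) \<psi>)
        \<le> sqrt (real (Suc ?K)) * nm ?K (\<beta> - fun_scale (real ?K - real j) \<theta>)"
      using cobd_norm_le[OF kn] by simp
    also have "\<dots> \<le> sqrt (real (Suc ?K)) * (real ?K * sqrt (real ?K) * ?\<epsilon> * nm ?K \<theta>)"
      using step(1) by (intro mult_left_mono) auto
    also have "\<dots> = sqrt (real ?K + 1) * (real ?K * sqrt (real ?K) * ?\<epsilon> * nm ?K \<theta>)"
      by (simp add: add.commute)
    also have "\<dots> \<le> 2 * real ?K * (1 + 2 * real ?K * sqrt (real ?K)) * ?\<epsilon> * nm (Suc ?K) \<psi>"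
    proof (rule error_constant_step)
      show "?\<epsilon> \<le> 1 / (2 * (1 + 2 * real ?K * sqrt (real ?K)))"
        using small Suc.prems(1) by (simp add: add.commute)
      show "(1 - ?\<epsilon> * sqrt (real ?K)) * (nm ?K \<theta>)\<^sup>2 \<le> (nm (Suc ?K) \<psi>)\<^sup>2"
        using step(2) by (simp add: L.wnorm_power2 \<beta>_dot flip: \<theta>(2))
    qed (simp_all add: eps_nonneg)
    finally show ?thesis .
  qed
  have "cobd_adj (Suc ?K) (cobd (Suc ?K) \<psi>) - fun_scale (real ?K + 1 - real j) \<psi>
      = (cobd_adj (Suc ?K) (cobd (Suc ?K) \<psi>) - \<psi> - cobd ?K (cobd_adj ?K \<psi>))
        + (cobd ?K (cobd_adj ?K \<psi>) - fun_scale (real ?K - real j) \<psi>)" (is "?D = ?A + ?B")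
    by (simp add: fun_eq_iff algebra_simps)
  then have "nm (Suc ?K) ?D \<le> nm (Suc ?K) ?A + nm (Suc ?K) ?B"
    by (simp only: L.wnorm_triangle)
  also have "\<dots> \<le> real (Suc ?K) * lam * nm (Suc ?K) \<psi>
        + 2 * real ?K * (1 + 2 * real ?K * sqrt (real ?K)) * ?\<epsilon> * nm (Suc ?K) \<psi>"
    by (rule add_mono[OF T main])
  also have "\<dots> = eps lam ?K * nm (Suc ?K) \<psi>" by (simp add: algebra_simps)
  finally show ?case .
qed

lemma orth_proj_in:
  assumes "fs.subspace W" "W \<subseteq> cochains X k" "\<phi> \<in> cochains X k"
  shows "orth_proj X m k W \<phi> \<in> W"
proof -
  have W: "W \<subseteq> supported (level (Suc k))" using assms(2) by (simp add: cochains_eq)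
  obtain p where p: "p \<in> W" "\<And>g. g \<in> W \<Longrightarrow> ip (Suc k) (\<phi> - p) g = 0"
    using L.projection_exists[OF assms(1) W] by blast
  have "\<phi> - p \<in> cochains X k"
    using assms p(1) by (simp add: cochains_eq) (meson fs.subspace_diff subspace_supported subset_iff)
  then have "p \<in> W \<and> \<phi> - p \<in> orth_compl X m k W" using p by (simp add: orth_compl_def cinner_eq)
  moreover have "q = p" if "q \<in> W \<and> \<phi> - q \<in> orth_compl X m k W" for q
    using that p by (intro L.projection_unique[OF assms(1) W]) (auto simp: orth_compl_def cinner_eq)
  ultimately have "orth_proj X m k W \<phi> = p" unfolding orth_proj_def by (rule the_equality)
  then show ?thesis using p(1) by simp
qed

end

theorem corollary5p8:
  fixes X :: "'a set set" and n :: nat and m :: "'a set \<Rightarrow> real" and lam :: real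
  assumes "1 \<le> n"
    and "pure_complex X n"
    and "weight_function X n m"
    and "two_sided_local_spectral_expander X n m lam"
    and "\<forall>k. k + 2 \<le> n \<longrightarrow>
           eps lam k \<le> 1 / (2 * (1 + 2 * (real k + 1) * sqrt (real k + 1)))"
  shows "\<forall>k j \<phi>. k \<le> n - 1 \<and> j \<le> k \<and> \<phi> \<in> cochains0 X m k \<longrightarrow>
    cnorm X m k (\<lambda>\<tau>. upper_walk X m k (orth_proj X m k (Uspace X m k j) \<phi>) \<tau>
        - (real k + 1 - real j) / (real k + 2) * orth_proj X m k (Uspace X m k j) \<phi> \<tau>)
      \<le> eps lam k / (real k + 2) * cnorm X m k (orth_proj X m k (Uspace X m k j) \<phi>)"
proof (intro allI impI)
  interpret local_expander X n m lam
    using assms(1-4) by unfold_locales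
  interpret L: weighted_set "level c" m for c
    by (rule weighted_set_level)
  fix k j \<phi> assume *: "k \<le> n - 1 \<and> j \<le> k \<and> \<phi> \<in> cochains0 X m k"
  then have kj: "Suc k \<le> n" "k \<le> n" "j \<le> k" using assms(1) by auto
  let ?U = "Uspace X m k j"
  define \<psi> where "\<psi> = orth_proj X m k ?U \<phi>"
  have U: "?U = Ucomp k j" using kj by (intro Uspace_eq)
  have "?U \<subseteq> cochains X k"
    using Fil_supported[OF kj(3,2)] by (auto simp: U Ucomp_def cochains_eq)
  then have "\<psi> \<in> Ucomp k j"
    using orth_proj_in[of ?U k \<phi>] subspace_Ucomp[OF kj(3)] * by (simp add: \<psi>_def U cochains0_def)
  note bound = up_walk_near_scalar_on_Ucomp[OF assms(5) kj(1,3) this]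
  have "(\<lambda>\<tau>. upper_walk X m k \<psi> \<tau> - (real k + 1 - real j) / (real k + 2) * \<psi> \<tau>)
      = fun_scale (1 / (real k + 2)) (cobd_adj (Suc k) (cobd (Suc k) \<psi>) - fun_scale (real k + 1 - real j) \<psi>)"
    by (simp add: upper_walk_eq[OF kj(1)] fun_eq_iff right_diff_distrib)
  then have "cnorm X m k (\<lambda>\<tau>. upper_walk X m k \<psi> \<tau> - (real k + 1 - real j) / (real k + 2) * \<psi> \<tau>)
      = 1 / (real k + 2) * nm (Suc k) (cobd_adj (Suc k) (cobd (Suc k) \<psi>) - fun_scale (real k + 1 - real j) \<psi>)"
    by (simp only: cnorm_eq L.wnorm_scale) simp
  also have "\<dots> \<le> 1 / (real k + 2) * (eps lam k * nm (Suc k) \<psi>)"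
    using bound by (intro mult_left_mono) auto
  finally show "cnorm X m k (\<lambda>\<tau>. upper_walk X m k (orth_proj X m k ?U \<phi>) \<tau>
        - (real k + 1 - real j) / (real k + 2) * orth_proj X m k ?U \<phi> \<tau>)
      \<le> eps lam k / (real k + 2) * cnorm X m k (orth_proj X m k ?U \<phi>)"
    by (simp add: \<psi>_def cnorm_eq)
qed

end
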